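(* Let $G$ be an acyclic graph on vertex set $[n+1]$. Then the root polytope $\mathcal{P}(G)$ is affinely equivalent to $\mathcal{S}(G)=p(\mathcal{F}_{\tilde G})$, which is a projection of the flow polytope $\mathcal{F}_{\tilde G}$. Indeed, $\mathcal{P}(G)=f(p(\mathcal{F}_{\tilde G}))$, and $f$ restricted to $\mathcal{S}(G)$ is an affine bijection onto $\mathcal{P}(G)$. Moreover, suppose the same sequence of reductions is performed starting from $G$, producing (i) a dissection $\mathcal{D}_1$ of $\mathcal{P}(G)$ into root polytopes $\mathcal{P}(H)$, and (ii) a dissection $\mathcal{D}_2$ of $\mathcal{F}_{\tilde G}$ into flow polytopes $\mathcal{F}_{\tilde H}$, where in each case a graph $G_0$ is replaced by $G_1$ and $G_2$ (with intersection corresponding to $G_3$). Then $\mathcal{D}_1$ is the image of $\mathcal{D}_2$ under $f\circ p$. In particular, $f(p(\mathcal{F}_{\tilde H}))=\mathcal{P}(H)$ for every graph $H$ arising in the process.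
   Context: Root polytopes: let $e_1,\dots,e_{n+1}$ be the standard basis of $\mathbb{R}^{n+1}$ and $\Phi^+=\{e_i-e_j:1\le i<j\le n+1\}$. For a graph $G$ on $[n+1]$ (edges written $(i,j)$ with $i<j$), let $\mathcal{C}(G)$ be the cone of nonnegative combinations of $\{e_i-e_j:(i,j)\in E(G)\}$. The root polytope is $\mathcal{P}(G)=\mathrm{ConvHull}(\{0\}\cup(\Phi^+\cap\mathcal{C}(G)))$. Flow polytopes: let $\tilde G$ be the graph on vertex set $[n+1]\cup\{s,t\}$ with edge set $E(G)\cup\{(s,i),(i,t):i\in[n+1]\}$, ordered by $s<1<\dots<n+1<t$, with edges directed from the smaller to the larger endpoint. The flow polytope $\mathcal{F}_{\tilde G}\subset\mathbb{R}^{E(\tilde G)}$ is the set of $f:E(\tilde G)\to\mathbb{R}_{\ge0}$ such that the total flow out of $s$ is $1$, the total flow into $t$ is $1$, and at each other vertex inflow equals outflow. Maps: with coordinate vectors $e_{(a,b)}$ of $\mathbb{R}^{E(\tilde G)}$, let $W$ be the span of $\{e_{(i,j)}:(i,j)\in E(G)\}$. Let $p$ be the orthogonal projection onto $W$, and let $f:W\to\mathbb{R}^{n+1}$ be the linear map with $f(e_{(i,j)})=e_i-e_j$. Reductions: given $G_0$ on $[n+1]$ with edges $(i,j),(j,k)$, $i<j<k$, define $E(G_1)=E(G_0)\setminus\{(j,k)\}\cup\{(i,k)\}$, $E(G_2)=E(G_0)\setminus\{(i,j)\}\cup\{(i,k)\}$, $E(G_3)=E(G_0)\setminus\{(i,j),(j,k)\}\cup\{(i,k)\}$.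 For acyclic $G_0$ one has $\mathcal{P}(G_0)=\mathcal{P}(G_1)\cup\mathcal{P}(G_2)$ with $\mathcal{P}(G_1)\cap\mathcal{P}(G_2)=\mathcal{P}(G_3)$ (same dimension for the first three, one less for the last). Analogously, $\mathcal{F}_{\tilde G_0}=\mathcal{F}_{\tilde G_1}\cup\mathcal{F}_{\tilde G_2}$ with intersection $\mathcal{F}_{\tilde G_3}$. Repeating this yields the dissections. *)

theory Defs
  imports "HOL-Analysis.Analysis"
begin

text \<open>
  The vertex set \<open>[n+1]\<close> is rendered as an arbitrary type \<open>'v :: {finite, linorder}\<close>; such a type is
  nonempty, and it is order-isomorphic to \<open>{1 < \<dots> < n+1}\<close> for \<open>n + 1 = CARD('v)\<close>.  Accordingly
  the space of real \<open>(n+1)\<close>-vectors is \<open>real ^ 'v\<close>.  A graph is given by its edge set, each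
  edge \<open>{i, j}\<close> being stored once, as the pair \<open>(i, j)\<close> with \<open>i < j\<close>.
\<close>

type_synonym 'v graph = "('v \<times> 'v) set"

definition simple_graph :: "'v::linorder graph \<Rightarrow> bool" where
  "simple_graph E \<longleftrightarrow> (\<forall>(i, j) \<in> E. i < j)"

definition adjacent :: "'v graph \<Rightarrow> 'v \<Rightarrow> 'v \<Rightarrow> bool" where
  "adjacent E u v \<longleftrightarrow> (u, v) \<in> E \<or> (v, u) \<in> E"

text \<open>Acyclicity refers to the underlying undirected graph.\<close>

definition acyclic_graph :: "'v graph \<Rightarrow> bool" where
  "acyclic_graph E \<longleftrightarrow>
     \<not> (\<exists>vs. 3 \<le> length vs \<and> distinct vs \<and>
          (\<forall>m < length vs. adjacent E (vs ! m) (vs ! (Suc m mod length vs))))"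


section \<open>Root polytopes\<close>

definition root_vec :: "'v::finite \<times> 'v \<Rightarrow> real ^ 'v" where
  "root_vec e = axis (fst e) 1 - axis (snd e) 1"

definition positive_roots :: "((real, 'v::{finite, linorder}) vec) set" where
  "positive_roots = {root_vec (i, j) | i j. i < j}"

definition root_cone :: "'v::finite graph \<Rightarrow> (real ^ 'v) set" where
  "root_cone E = {(\<Sum>e\<in>E. c e *\<^sub>R root_vec e) | c. \<forall>e\<in>E. 0 \<le> c e}"

definition root_polytope :: "'v::{finite, linorder} graph \<Rightarrow> ((real, 'v) vec) set" where
  "root_polytope E = convex hull ({0} \<union> (positive_roots \<inter> root_cone E))"


section \<open>Flow polytopes\<close>

datatype 'v aug_vertex = Source | Inner 'v | Sink

instance aug_vertex :: (finite) finite
proof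
  have "(UNIV :: 'a aug_vertex set) = insert Source (insert Sink (range Inner))"
    by (auto intro: aug_vertex.exhaust)
  then show "finite (UNIV :: 'a aug_vertex set)"
    by (metis finite_code finite_imageI finite_insert)
qed

text \<open>
  Edges of the augmented graph are pairs (tail, head); as \<open>s < 1 < \<dots> < n+1 < t\<close>, all edges at the
  source leave it and all edges at the sink enter it.
\<close>

definition inner_edge :: "'v \<times> 'v \<Rightarrow> 'v aug_vertex \<times> 'v aug_vertex" where
  "inner_edge e = (Inner (fst e), Inner (snd e))"

definition aug_graph :: "'v graph \<Rightarrow> 'v aug_vertex graph" where
  "aug_graph E = inner_edge ` E \<union> {(Source, Inner i) | i. True} \<union> {(Inner i, Sink) | i. True}"

text \<open>
  For every graph on \<open>'v\<close>, the space of real vectors indexed by the edges of its augmented graph is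
  taken to be the coordinate subspace of the following space consisting of the vectors that vanish
  at all other pairs.
\<close>

type_synonym 'v flow_space = "real ^ ('v aug_vertex \<times> 'v aug_vertex)"

definition outflow :: "'v aug_vertex graph \<Rightarrow> 'v::finite flow_space \<Rightarrow> 'v aug_vertex \<Rightarrow> real" where
  "outflow A x v = (\<Sum>e | e \<in> A \<and> fst e = v. x $ e)"

definition inflow :: "'v aug_vertex graph \<Rightarrow> 'v::finite flow_space \<Rightarrow> 'v aug_vertex \<Rightarrow> real" where
  "inflow A x v = (\<Sum>e | e \<in> A \<and> snd e = v. x $ e)"

definition flow_polytope :: "'v::finite graph \<Rightarrow> 'v flow_space set" where
  "flow_polytope E = {x.
     (\<forall>e. e \<notin> aug_graph E \<longrightarrow> x $ e = 0) \<and>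
     (\<forall>e \<in> aug_graph E. 0 \<le> x $ e) \<and>
     outflow (aug_graph E) x Source = 1 \<and>
     inflow (aug_graph E) x Sink = 1 \<and>
     (\<forall>i. inflow (aug_graph E) x (Inner i) = outflow (aug_graph E) x (Inner i))}"


section \<open>The maps from flow polytopes to root polytopes\<close>

definition edge_subspace :: "'v::finite graph \<Rightarrow> 'v flow_space set" where
  "edge_subspace E = span {axis (inner_edge e) 1 | e. e \<in> E}"

definition orth_proj :: "'a::euclidean_space set \<Rightarrow> 'a \<Rightarrow> 'a" where
  "orth_proj W x = (THE y. y \<in> W \<and> (\<forall>w\<in>W. orthogonal (x - y) w))"

definition proj_map :: "'v::finite graph \<Rightarrow> 'v flow_space \<Rightarrow> 'v flow_space" where
  "proj_map E = orth_proj (edge_subspace E)"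

text \<open>
  Defined on the whole flow space, but only its restriction to \<open>edge_subspace E\<close> is of interest; see
  \<open>root_map_unique\<close> below.
\<close>

definition root_map :: "'v::finite graph \<Rightarrow> 'v flow_space \<Rightarrow> real ^ 'v" where
  "root_map E x = (\<Sum>e\<in>E. x $ inner_edge e *\<^sub>R root_vec e)"

definition projected_flow_polytope :: "'v::finite graph \<Rightarrow> 'v flow_space set" where
  "projected_flow_polytope E = proj_map E ` flow_polytope E"

definition affine_bijection ::
  "('a::real_vector \<Rightarrow> 'b::real_vector) \<Rightarrow> 'a set \<Rightarrow> 'b set \<Rightarrow> bool" where
  "affine_bijection g S T \<longleftrightarrow>
     (\<exists>h c. linear h \<and> (\<forall>x\<in>S. g x = h x + c)) \<and> bij_betw g S T"

definition affinely_equivalent :: "'a::real_vector set \<Rightarrow> 'b::real_vector set \<Rightarrow> bool" where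
  "affinely_equivalent S T \<longleftrightarrow> (\<exists>g. affine_bijection g S T)"

lemma orth_proj_works:
  fixes W :: "'a::euclidean_space set"
  assumes "subspace W"
  shows "orth_proj W x \<in> W \<and> (\<forall>w\<in>W. orthogonal (x - orth_proj W x) w)"
proof -
  obtain y z where y: "y \<in> span W" and z: "\<And>w. w \<in> span W \<Longrightarrow> orthogonal z w" and x: "x = y + z"
    using orthogonal_subspace_decomp_exists[of W x] by metis
  have W: "span W = W" using assms by (simp add: span_eq_iff)
  show ?thesis
    unfolding orth_proj_def
  proof (rule theI[of _ y])
    show "y \<in> W \<and> (\<forall>w\<in>W. orthogonal (x - y) w)"
      using y z x W by simp
  next
    fix y' assume y': "y' \<in> W \<and> (\<forall>w\<in>W. orthogonal (x - y') w)"
    have "y' - y \<in> W" using y y' W assms by (simp add: subspace_diff)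
    then have "orthogonal (x - y) (y' - y)" "orthogonal (x - y') (y' - y)"
      using y' z x W by auto
    then have "orthogonal ((x - y) - (x - y')) (y' - y)"
      by (simp add: orthogonal_def inner_diff_left)
    then show "y' = y" by (simp add: orthogonal_self)
  qed
qed

lemma inner_edge_eq_iff [simp]: "inner_edge e = inner_edge e' \<longleftrightarrow> e = e'"
  by (auto simp: inner_edge_def prod_eq_iff)

lemma linear_root_map: "linear (root_map E)"
  unfolding root_map_def
  by (intro linear_compose_sum ballI linearI) (auto simp: algebra_simps)

lemma root_map_axis:
  fixes E :: "'v::finite graph"
  assumes "e \<in> E"
  shows "root_map E (axis (inner_edge e) 1) = root_vec e"
proof -
  have "root_map E (axis (inner_edge e) 1) = (\<Sum>e'\<in>E. if e' = e then root_vec e' else 0)"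
    unfolding root_map_def by (intro sum.cong) (auto simp: axis_def)
  also have "\<dots> = root_vec e"
    using assms by (simp add: sum.delta)
  finally show ?thesis .
qed

lemma root_map_unique:
  fixes E :: "'v::finite graph"
  assumes "linear g" and "\<And>e. e \<in> E \<Longrightarrow> g (axis (inner_edge e) 1) = root_vec e"
    and "x \<in> edge_subspace E"
  shows "g x = root_map E x"
  using assms(3) unfolding edge_subspace_def
  by (rule linear_eq_on_span[OF assms(1) linear_root_map, rotated])
     (auto simp: assms(2) root_map_axis)


section \<open>Reductions and dissections\<close>

definition reduct1 :: "'v \<Rightarrow> 'v \<Rightarrow> 'v \<Rightarrow> 'v graph \<Rightarrow> 'v graph" where
  "reduct1 i j k E = (E - {(j, k)}) \<union> {(i, k)}"

definition reduct2 :: "'v \<Rightarrow> 'v \<Rightarrow> 'v \<Rightarrow> 'v graph \<Rightarrow> 'v graph" where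
  "reduct2 i j k E = (E - {(i, j)}) \<union> {(i, k)}"

definition reduct3 :: "'v \<Rightarrow> 'v \<Rightarrow> 'v \<Rightarrow> 'v graph \<Rightarrow> 'v graph" where
  "reduct3 i j k E = (E - {(i, j), (j, k)}) \<union> {(i, k)}"

text \<open>
  The flow polytopes of the three reducts of a graph \<open>G\<^sub>0\<close> live in other coordinate subspaces than
  that of \<open>G\<^sub>0\<close>.  They are identified with subsets of the flow polytope of \<open>G\<^sub>0\<close> in the standard
  way: the flow on the new edge \<open>(i, k)\<close> is sent along \<open>i \<rightarrow> j \<rightarrow> k\<close> instead, that is, the linear
  map below replaces the coordinate vector of \<open>(i, k)\<close> by the sum of those of \<open>(i, j)\<close> and \<open>(j, k)\<close>
  and fixes all other coordinate vectors.
\<close>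

definition reroute :: "'v \<Rightarrow> 'v \<Rightarrow> 'v \<Rightarrow> 'v::finite flow_space \<Rightarrow> 'v flow_space" where
  "reroute i j k x = x + x $ inner_edge (i, k) *\<^sub>R
     (axis (inner_edge (i, j)) 1 + axis (inner_edge (j, k)) 1 - axis (inner_edge (i, k)) 1)"

text \<open>
  \<open>reduction_state G D\<close>: the collection \<open>D\<close> is obtained from \<open>G\<close> by a finite sequence of reductions,
  each of which replaces one graph of the current collection by its first two reducts.
  Every graph \<open>H\<close> in \<open>D\<close> is paired with the composite \<open>\<phi>\<close> of rerouting maps, which embeds the flow
  polytope of \<open>H\<close> into that of \<open>G\<close>.
\<close>

inductive reduction_state ::
  "'v::{finite, linorder} graph \<Rightarrow> ('v graph \<times> ('v flow_space \<Rightarrow> 'v flow_space)) set \<Rightarrow> bool"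
  for G where
  start: "reduction_state G {(G, id)}"
| reduce: "reduction_state G
    (insert (reduct1 i j k G\<^sub>0, \<phi> \<circ> reroute i j k)
      (insert (reduct2 i j k G\<^sub>0, \<phi> \<circ> reroute i j k) (D - {(G\<^sub>0, \<phi>)})))"
  if "reduction_state G D" "(G\<^sub>0, \<phi>) \<in> D" "(i, j) \<in> G\<^sub>0" "(j, k) \<in> G\<^sub>0" "i < j" "j < k"

definition root_pieces ::
  "('v::{finite, linorder} graph \<times> ('v flow_space \<Rightarrow> 'v flow_space)) set \<Rightarrow> ((real, 'v) vec) set set" where
  "root_pieces D = {root_polytope H | H \<phi>. (H, \<phi>) \<in> D}"

definition flow_pieces ::
  "('v::finite graph \<times> ('v flow_space \<Rightarrow> 'v flow_space)) set \<Rightarrow> 'v flow_space set set" where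
  "flow_pieces D = {\<phi> ` flow_polytope H | H \<phi>. (H, \<phi>) \<in> D}"

definition is_dissection :: "'a::euclidean_space set set \<Rightarrow> 'a set \<Rightarrow> bool" where
  "is_dissection \<D> P \<longleftrightarrow>
     finite \<D> \<and> (\<forall>C\<in>\<D>. polytope C \<and> aff_dim C = aff_dim P) \<and> \<Union>\<D> = P \<and>
     (\<forall>C\<in>\<D>. \<forall>C'\<in>\<D>. C \<noteq> C' \<longrightarrow> rel_interior C \<inter> rel_interior C' = {})"

end

theory Submission
  imports Defs
begin

text \<open>
  A flow is conserved iff its boundary \<open>\<Sum>x\<^sub>e (e\<^bsub>tail\<^esub> - e\<^bsub>head\<^esub>)\<close> equals \<open>e\<^sub>s - e\<^sub>t\<close>; the part of this
  boundary coming from the edges of \<open>G\<close> is \<open>f (p x)\<close>.  Decomposing a flow into paths exhibits \<open>f (p x)\<close>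
  as a convex combination of \<open>0\<close> and positive roots in the cone, so \<open>f \<circ> p\<close> maps \<open>\<F>\<close> onto \<open>\<P>\<close>.

  Rerouting the new edge \<open>(i, k)\<close> along \<open>i \<rightarrow> j \<rightarrow> k\<close> changes neither the boundary nor the image under
  \<open>f \<circ> p\<close>, and identifies the flow polytopes of the three reducts with the parts of that of \<open>G\<^sub>0\<close>
  where \<open>x\<^bsub>(i,j)\<^esub> - x\<^bsub>(j,k)\<^esub>\<close> is nonnegative, nonpositive and zero.  For an acyclic graph the roots of the edges
  are linearly independent, so this difference descends to a linear functional on the root polytope.
  On both sides a reduction thus cuts a convex set by a hyperplane having points of the set on either
  side: the halves keep the affine hull, and their relative interiors are disjoint.  Independence is
  preserved by reductions because \<open>e\<^sub>i - e\<^sub>k\<close> is exchanged for one of its two summands.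
\<close>

section \<open>Halving a convex set\<close>

text \<open>A point \<open>x\<close> of \<open>S\<close> lies on the line through \<open>p\<close>
  and some \<open>y\<close> between them, and \<open>y\<close> taken close enough to
  \<open>p\<close> is still in the half.\<close>

lemma half_same_affine_hull:
  fixes f :: "'a::euclidean_space \<Rightarrow> real"
  assumes "convex S" "linear f" "p \<in> S" "f p > 0"
  shows "affine hull {x \<in> S. f x \<ge> 0} = affine hull S"
proof
  let ?T = "{x \<in> S. f x \<ge> 0}"
  show "affine hull ?T \<subseteq> affine hull S"
    by (rule hull_mono) auto
  have "x \<in> affine hull ?T" if x: "x \<in> S" for x
  proof -
    \<comment> \<open>With this weight \<open>f y = u * (\<bar>f x\<bar> + f x)\<close>, which is
      nonnegative; as \<open>u\<close> is positive, \<open>x\<close> can be recovered from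
      \<open>p\<close> and \<open>y\<close>.\<close>
    define u where "u = f p / (f p + \<bar>f x\<bar>)"
    have u: "0 < u" "u \<le> 1" and fp: "(1 - u) * f p = u * \<bar>f x\<bar>"
      using assms(4) by (auto simp: u_def field_simps)
    define y where "y = (1 - u) *\<^sub>R p + u *\<^sub>R x"
    have "y \<in> S"
      unfolding y_def using assms(1,3) x u by (intro convexD) auto
    moreover have "f y = u * \<bar>f x\<bar> + u * f x"
      using fp by (simp add: y_def linear_add[OF assms(2)] linear_scale[OF assms(2)])
    then have "f y \<ge> 0"
      using u by (simp flip: distrib_left)
    ultimately have "y \<in> affine hull ?T" "p \<in> affine hull ?T"
      using assms(3,4) by (auto intro: hull_inc)
    then have "(1 - 1 / u) *\<^sub>R p + (1 / u) *\<^sub>R y \<in> affine hull ?T"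
      by (intro mem_affine) auto
    moreover have "(1 - 1 / u) *\<^sub>R p + (1 / u) *\<^sub>R y = x"
      using u by (simp add: y_def algebra_simps)
    ultimately show ?thesis by simp
  qed
  then show "affine hull S \<subseteq> affine hull ?T"
    by (intro hull_minimal) auto
qed

text \<open>If \<open>f z = 0\<close>, the segment from \<open>p\<close> to \<open>z\<close> could
  be prolonged a little beyond \<open>z\<close> inside the half, but there \<open>f\<close> is
  negative.\<close>

lemma rel_interior_half_disjoint:
  fixes f :: "'a::euclidean_space \<Rightarrow> real"
  assumes "convex S" "linear f" "p \<in> S" "f p > 0"
    and z: "z \<in> rel_interior {x \<in> S. f x \<ge> 0}"
  shows "f z > 0"
proof (rule ccontr)
  let ?T = "{x \<in> S. f x \<ge> 0}"
  assume "\<not> f z > 0"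
  with z have fz: "f z = 0"
    using rel_interior_subset[of ?T] by fastforce
  have "convex ?T"
  proof -
    have "convex (S \<inter> f -` {0..})"
      by (intro convex_Int convex_linear_vimage assms) auto
    then show ?thesis by (simp add: vimage_def Int_def)
  qed
  moreover have "p \<in> ?T" using assms by auto
  ultimately obtain e where "e > 1" "(1 - e) *\<^sub>R p + e *\<^sub>R z \<in> ?T"
    using z convex_rel_interior_iff[of ?T z] by blast
  then have "0 \<le> (1 - e) * f p"
    using fz by (simp add: linear_add[OF assms(2)] linear_scale[OF assms(2)])
  with \<open>e > 1\<close> assms(4) show False
    by (simp add: zero_le_mult_iff)
qed

section \<open>Dissections as indexed families\<close>

text \<open>
  A family of sets indexed by \<open>D\<close>; unlike for \<open>is_dissection\<close>, pieces with different indices are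
  required to have disjoint relative interiors even if they coincide as sets, which is what makes the
  notion stable under subdividing a single piece.
\<close>

definition indexed_dissection :: "'i set \<Rightarrow> ('i \<Rightarrow> 'a::euclidean_space set) \<Rightarrow> 'a set \<Rightarrow> bool" where
  "indexed_dissection D C P \<longleftrightarrow>
     finite D \<and> (\<forall>d\<in>D. polytope (C d) \<and> affine hull C d = affine hull P) \<and> (\<Union>d\<in>D. C d) = P \<and>
     (\<forall>d\<in>D. \<forall>d'\<in>D. d \<noteq> d' \<longrightarrow> rel_interior (C d) \<inter> rel_interior (C d') = {})"

lemma indexed_dissection_imp_is_dissection:
  assumes "indexed_dissection D C P"
  shows "is_dissection (C ` D) P"
  unfolding is_dissection_def
proof (intro conjI ballI impI)
  show "finite (C ` D)" "\<Union> (C ` D) = P"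
    using assms by (simp_all add: indexed_dissection_def)
next
  fix X assume "X \<in> C ` D"
  then have "polytope X \<and> affine hull X = affine hull P"
    using assms unfolding indexed_dissection_def by blast
  then show "polytope X" "aff_dim X = aff_dim P"
    using aff_dim_affine_hull2 by blast+
next
  fix X Y assume "X \<in> C ` D" "Y \<in> C ` D" "X \<noteq> Y"
  then obtain d d' where "X = C d" "Y = C d'" "d \<in> D" "d' \<in> D" "d \<noteq> d'"
    by blast
  then show "rel_interior X \<inter> rel_interior Y = {}"
    using assms by (simp add: indexed_dissection_def)
qed

text \<open>Equal affine hulls place the relative interiors of the new pieces inside that of
  \<open>C d\<close>, so disjointness from the remaining pieces is inherited.\<close>

lemma indexed_dissection_subdivide:
  assumes D: "indexed_dissection D C P" and "d \<in> D"
    and un: "C a \<union> C b = C d"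
    and hull: "affine hull C a = affine hull C d" "affine hull C b = affine hull C d"
    and poly: "polytope (C a)" "polytope (C b)"
    and disj: "rel_interior (C a) \<inter> rel_interior (C b) = {}"
  shows "indexed_dissection (insert a (insert b (D - {d}))) C P"
proof -
  have sub: "rel_interior (C a) \<subseteq> rel_interior (C d)" "rel_interior (C b) \<subseteq> rel_interior (C d)"
    using un by (intro subset_rel_interior hull; blast)+
  have old: "rel_interior (C d) \<inter> rel_interior (C d') = {}" if "d' \<in> D" "d \<noteq> d'" for d'
    using D \<open>d \<in> D\<close> that by (simp add: indexed_dissection_def)
  have piece: "polytope (C x)" "affine hull C x = affine hull P" if "x \<in> D" for x
    using D that by (simp_all add: indexed_dissection_def)
  show ?thesis
    unfolding indexed_dissection_def
  proof (intro conjI ballI impI)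
    show "finite (insert a (insert b (D - {d})))"
      using D by (simp add: indexed_dissection_def)
  next
    have "(\<Union>d\<in>D. C d) = P" using D by (simp add: indexed_dissection_def)
    then show "(\<Union>d\<in>insert a (insert b (D - {d})). C d) = P"
      using \<open>d \<in> D\<close> un by blast
  next
    fix x assume "x \<in> insert a (insert b (D - {d}))"
    then consider "x = a" | "x = b" | "x \<in> D" by blast
    then show "polytope (C x)" "affine hull C x = affine hull P"
      by (cases; simp only: piece \<open>d \<in> D\<close> poly hull)+
  next
    fix x y assume xy: "x \<in> insert a (insert b (D - {d}))" "y \<in> insert a (insert b (D - {d}))" "x \<noteq> y"
    \<comment> \<open>The indices \<open>a\<close> and \<open>b\<close> may already occur in
      \<open>D\<close>; pairs inside \<open>D\<close> are settled by the given dissection.\<close>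
    then consider "x \<in> D" "y \<in> D" | "x \<in> {a, b}" "y \<in> D - {d}"
      | "x \<in> D - {d}" "y \<in> {a, b}" | "x \<in> {a, b}" "y \<in> {a, b}"
      by blast
    then show "rel_interior (C x) \<inter> rel_interior (C y) = {}"
    proof cases
      case 1
      then show ?thesis using D \<open>x \<noteq> y\<close> by (simp add: indexed_dissection_def)
    next
      case 2
      then show ?thesis using sub old[of y] by blast
    next
      case 3
      then show ?thesis using sub old[of x] by blast
    next
      case 4
      then show ?thesis using disj \<open>x \<noteq> y\<close> by blast
    qed
  qed
qed

text \<open>The map \<open>g\<close> serves the flow pieces, which are images under composites of
  rerouting maps; for root polytopes it is the identity. Linear images commute with affine hulls and
  with relative interiors of convex sets, and injectivity keeps the latter disjoint.\<close>

lemma linear_image_halves: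
  fixes f :: "'a::euclidean_space \<Rightarrow> real" and g :: "'a \<Rightarrow> 'b::euclidean_space"
  assumes S: "convex S" and f: "linear f" and g: "linear g" "inj_on g S"
    and p: "p \<in> S" "f p > 0" and q: "q \<in> S" "f q < 0"
  shows "affine hull (g ` {x \<in> S. f x \<ge> 0}) = affine hull (g ` S)"
    and "affine hull (g ` {x \<in> S. f x \<le> 0}) = affine hull (g ` S)"
    and "rel_interior (g ` {x \<in> S. f x \<ge> 0}) \<inter> rel_interior (g ` {x \<in> S. f x \<le> 0}) = {}"
proof -
  let ?S1 = "{x \<in> S. f x \<ge> 0}" and ?S2 = "{x \<in> S. f x \<le> 0}"
  have f': "linear (\<lambda>x. - f x)" using f by (rule linear_compose_neg)
  have bl: "bounded_linear g" using g linear_conv_bounded_linear by blast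
  have "affine hull ?S1 = affine hull S"
    using half_same_affine_hull[OF S f p] .
  then show "affine hull (g ` ?S1) = affine hull (g ` S)"
    by (simp flip: affine_hull_linear_image[OF bl])
  have "affine hull ?S2 = affine hull S"
    using half_same_affine_hull[OF S f' q(1)] q(2) by simp
  then show "affine hull (g ` ?S2) = affine hull (g ` S)"
    by (simp flip: affine_hull_linear_image[OF bl])
  have half_eq: "?S1 = S \<inter> f -` {0..}" "?S2 = S \<inter> f -` {..0}"
    by auto
  have "convex ?S1" "convex ?S2"
    unfolding half_eq by (intro convex_Int convex_linear_vimage S f; auto)+
  then have ri: "rel_interior (g ` ?S1) = g ` rel_interior ?S1"
    "rel_interior (g ` ?S2) = g ` rel_interior ?S2"
    using g(1) by (simp_all add: rel_interior_convex_linear_image)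
  have "rel_interior ?S1 \<inter> ?S2 = {}"
    using rel_interior_half_disjoint[OF S f p] by force
  then have "rel_interior ?S1 \<inter> rel_interior ?S2 = {}"
    using rel_interior_subset[of ?S2] by blast
  moreover have "rel_interior ?S1 \<subseteq> S" "rel_interior ?S2 \<subseteq> S"
    using rel_interior_subset by blast+
  ultimately have "g ` rel_interior ?S1 \<inter> g ` rel_interior ?S2 = {}"
    by (simp flip: inj_on_image_Int[OF g(2)])
  then show "rel_interior (g ` ?S1) \<inter> rel_interior (g ` ?S2) = {}"
    by (simp add: ri)
qed

section \<open>Linear independence of the roots of an acyclic graph\<close>

lemma root_vec_nth: "root_vec e $ v = (if v = fst e then 1 else 0) - (if v = snd e then 1 else 0)"
  by (simp add: root_vec_def axis_def)

lemma root_vec_add: "root_vec (i, j) + root_vec (j, k) = root_vec (i, k)"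
  by (simp add: root_vec_def)

lemma root_vec_same [simp]: "root_vec (i, i) = 0"
  by (simp add: root_vec_def)

lemma inj_on_root_vec:
  fixes E :: "'v::{finite, linorder} graph"
  assumes "simple_graph E"
  shows "inj_on root_vec E"
proof (rule inj_onI)
  fix e e' assume "e \<in> E" "e' \<in> E" and eq: "root_vec e = root_vec e'"
  with assms have lt: "fst e < snd e" "fst e' < snd e'"
    by (auto simp: simple_graph_def)
  have "root_vec e $ fst e = root_vec e' $ fst e" "root_vec e $ snd e = root_vec e' $ snd e"
    using eq by simp_all
  with lt show "e = e'"
    by (auto simp: root_vec_nth prod_eq_iff split: if_splits)
qed

lemma adjacent_commute: "adjacent F u v \<longleftrightarrow> adjacent F v u"
  by (auto simp: adjacent_def)

text \<open>The first vertex of a longest path has a neighbour other than its successor. By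
  maximality this neighbour lies on the path, and the initial segment up to it closes to a
  cycle.\<close>

lemma no_leaf_imp_cycle:
  fixes F :: "'v::{finite, linorder} graph"
  assumes "simple_graph F" "adjacent F a b"
    and no_leaf: "\<And>u v. adjacent F u v \<Longrightarrow> \<exists>w. w \<noteq> v \<and> adjacent F u w"
  shows "\<not> acyclic_graph F"
proof -
  have irrefl: "u \<noteq> v" if "adjacent F u v" for u v
    using that assms(1) by (auto simp: adjacent_def simple_graph_def)
  define P where "P vs \<longleftrightarrow> 2 \<le> length vs \<and> distinct vs \<and>
    (\<forall>m. Suc m < length vs \<longrightarrow> adjacent F (vs ! m) (vs ! Suc m))" for vs
  have "P [a, b]"
    using assms(2) irrefl by (auto simp: P_def)
  moreover have "length vs < Suc (CARD('v))" if "P vs" for vs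
    using that unfolding P_def
    by (metis card_mono distinct_card finite less_Suc_eq_le top_greatest)
  ultimately obtain vs where vs: "P vs" and longest: "\<And>ws. P ws \<Longrightarrow> length ws \<le> length vs"
    using ex_has_greatest_nat[of P "[a, b]" length "Suc (CARD('v))"] by (metis less_imp_le)
  obtain x y zs where xyz: "vs = x # y # zs"
    using vs by (cases vs rule: remdups_adj.cases) (auto simp: P_def)
  have "adjacent F x y"
    using vs by (auto simp: P_def xyz dest!: spec[of _ 0])
  then obtain w where w: "w \<noteq> y" "adjacent F x w"
    using no_leaf by blast
  have "w \<in> set vs"
  proof (rule ccontr)
    assume "w \<notin> set vs"
    with vs w have "P (w # vs)"
      by (auto simp: P_def xyz nth_Cons adjacent_commute split: nat.splits)
    from longest[OF this] show False by simp
  qed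
  then obtain m where m: "m < length vs" "vs ! m = w"
    by (auto simp: in_set_conv_nth)
  have "w \<noteq> x" using irrefl[OF w(2)] by simp
  \<comment> \<open>As \<open>w\<close> is neither \<open>x\<close> nor \<open>y\<close>, the
    segment has at least the three vertices that \<open>acyclic_graph\<close> demands of a
    cycle.\<close>
  have "m \<noteq> 0" "m \<noteq> 1" using m w(1) \<open>w \<noteq> x\<close> by (auto simp: xyz intro: gr0I)
  then have m2: "2 \<le> m" by simp
  let ?c = "take (Suc m) vs"
  have len: "length ?c = Suc m" using m by simp
  have "adjacent F (?c ! l) (?c ! (Suc l mod length ?c))" if "l < length ?c" for l
  proof (cases "l = m")
    case True
    then have "?c ! l = w" "?c ! (Suc l mod length ?c) = x"
      using len m by (simp_all, simp add: xyz)
    then show ?thesis using w(2) by (simp add: adjacent_commute)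
  next
    case False
    then have "l < m" using that len by simp
    then show ?thesis using vs m by (simp add: P_def)
  qed
  moreover have "distinct ?c" using vs by (simp add: P_def)
  moreover have "3 \<le> length ?c" using len m2 by simp
  ultimately show ?thesis
    unfolding acyclic_graph_def by blast
qed

lemma acyclic_graph_subset: "acyclic_graph E \<Longrightarrow> F \<subseteq> E \<Longrightarrow> acyclic_graph F"
  unfolding acyclic_graph_def adjacent_def by blast

text \<open>The edges with nonzero coefficient in a linear relation form a subgraph without leaves:
  at a leaf only one root has a nonzero coordinate, and nothing could cancel it.\<close>

lemma independent_root_vec:
  fixes E :: "'v::{finite, linorder} graph"
  assumes "simple_graph E" "acyclic_graph E"
  shows "independent (root_vec ` E)"
proof
  assume "dependent (root_vec ` E)"
  then obtain u where "\<exists>v\<in>root_vec ` E. u v \<noteq> 0" "(\<Sum>v\<in>root_vec ` E. u v *\<^sub>R v) = 0"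
    by (auto simp: dependent_finite)
  then obtain c :: "'v \<times> 'v \<Rightarrow> real" where
    ne: "\<exists>e\<in>E. c e \<noteq> 0" and sum0: "(\<Sum>e\<in>E. c e *\<^sub>R root_vec e) = 0"
    using that[of "\<lambda>e. u (root_vec e)"]
    by (auto simp: sum.reindex inj_on_root_vec[OF assms(1)])
  define F where "F = {e \<in> E. c e \<noteq> 0}"
  have F: "F \<subseteq> E" "simple_graph F"
    using assms(1) by (auto simp: F_def simple_graph_def)
  have sumF: "(\<Sum>e\<in>F. c e *\<^sub>R root_vec e) = 0"
    unfolding F_def using sum0
    by (subst sum.mono_neutral_left[of E]) (auto simp: F_def)
  have "\<exists>w. w \<noteq> v \<and> adjacent F u w" if uv: "adjacent F u v" for u v
  proof (rule ccontr)
    assume no: "\<nexists>w. w \<noteq> v \<and> adjacent F u w"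
    obtain e where e: "e \<in> F" "e = (u, v) \<or> e = (v, u)"
      using uv by (auto simp: adjacent_def)
    have "root_vec e' $ u = 0" if "e' \<in> F" "e' \<noteq> e" for e'
    proof -
      have "fst e' \<noteq> u \<and> snd e' \<noteq> u"
        using no that e F(2) unfolding adjacent_def simple_graph_def
        by (cases e') (metis (mono_tags, lifting) case_prodD fst_conv less_asym snd_conv)
      then show ?thesis by (auto simp: root_vec_nth)
    qed
    then have "(\<Sum>e'\<in>F. c e' *\<^sub>R root_vec e') $ u = c e * root_vec e $ u"
      by (subst sum.remove[OF _ e(1)]) (auto intro!: sum.neutral)
    moreover have "u \<noteq> v" using e F(2) by (auto simp: simple_graph_def)
    then have "root_vec e $ u \<noteq> 0" using e(2) by (auto simp: root_vec_nth)
    moreover have "c e \<noteq> 0" using e(1) by (simp add: F_def)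
    ultimately show False using sumF by simp
  qed
  moreover obtain e where "e \<in> F" using ne by (auto simp: F_def)
  then have "adjacent F (fst e) (snd e)" by (simp add: adjacent_def)
  ultimately have "\<not> acyclic_graph F"
    using no_leaf_imp_cycle[OF F(2)] by blast
  then show False
    using acyclic_graph_subset[OF assms(2) F(1)] by contradiction
qed

text \<open>What is carried along reductions is independence of the roots instead of acyclicity. It
  also forces \<open>(i, k)\<close> to be a new edge, since otherwise three of the roots would be
  dependent.\<close>

lemma reduct_invariants:
  fixes H :: "'v::{finite, linorder} graph"
  assumes H: "simple_graph H" "independent (root_vec ` H)"
    and ij: "(i, j) \<in> H" and jk: "(j, k) \<in> H"
  shows "(i, k) \<notin> H"
    and "simple_graph (reduct1 i j k H)" "independent (root_vec ` reduct1 i j k H)"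
    and "simple_graph (reduct2 i j k H)" "independent (root_vec ` reduct2 i j k H)"
    and "simple_graph (reduct3 i j k H)"
proof -
  have lt: "i < j" "j < k" using H(1) ij jk by (auto simp: simple_graph_def)
  then have "i < k" by (rule less_trans)
  show simple: "simple_graph (reduct1 i j k H)" "simple_graph (reduct2 i j k H)"
    "simple_graph (reduct3 i j k H)"
    using H(1) \<open>i < k\<close> by (auto simp: simple_graph_def reduct1_def reduct2_def reduct3_def)
  have not_span: "root_vec e \<notin> span (root_vec ` (H - {e}))" if "e \<in> H" for e
    using H that inj_on_image_set_diff[OF inj_on_root_vec[OF H(1)], of H "{e}"]
    by (auto simp: dependent_def)
  have neq: "(i, j) \<noteq> (j, k)" using lt by auto
  \<comment> \<open>\<open>H - {e}\<close> keeps the other of the two edges, so the root of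
    \<open>e\<close> would be in the span as a difference.\<close>
  have exchange: "root_vec (i, k) \<notin> span (root_vec ` (H - {e}))"
    if "e = (i, j) \<or> e = (j, k)" for e
  proof
    assume ik: "root_vec (i, k) \<in> span (root_vec ` (H - {e}))"
    have "root_vec (i, j) = root_vec (i, k) - root_vec (j, k)"
      "root_vec (j, k) = root_vec (i, k) - root_vec (i, j)"
      by (simp_all add: root_vec_def)
    moreover have "root_vec e' \<in> span (root_vec ` (H - {e}))" if "e' \<in> H" "e' \<noteq> e" for e'
      using that by (intro span_base) auto
    ultimately have "root_vec e \<in> span (root_vec ` (H - {e}))"
      using that ij jk neq by (metis ik span_diff)
    moreover have "e \<in> H" using that ij jk by blast
    ultimately show False using not_span by blast
  qed
  show "(i, k) \<notin> H"
  proof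
    assume "(i, k) \<in> H"
    moreover have "(i, k) \<noteq> (j, k)" using lt by auto
    ultimately have "root_vec (i, k) \<in> span (root_vec ` (H - {(j, k)}))"
      by (intro span_base) auto
    with exchange show False by blast
  qed
  have "independent (insert (root_vec (i, k)) (root_vec ` (H - {e})))"
    if "e = (i, j) \<or> e = (j, k)" for e
  proof (intro independent_insertI exchange that)
    show "independent (root_vec ` (H - {e}))"
      using H(2) by (rule independent_mono) auto
  qed
  then show "independent (root_vec ` reduct1 i j k H)" "independent (root_vec ` reduct2 i j k H)"
    by (auto simp: reduct1_def reduct2_def image_Un)
qed

section \<open>Flows and their boundaries\<close>

text \<open>Summing over all pairs gives one linear map for all graphs at once, since a flow
  vanishes outside its own graph.\<close>

definition boundary :: "real ^ ('a \<times> 'a) \<Rightarrow> real ^ 'a::finite" where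
  "boundary x = (\<Sum>e\<in>UNIV. x $ e *\<^sub>R root_vec e)"

lemma linear_boundary: "linear boundary"
  unfolding boundary_def
  by (intro linear_compose_sum ballI linearI) (auto simp: algebra_simps)

lemma boundary_axis: "boundary (axis e 1) = root_vec e"
proof -
  have "boundary (axis e 1) = (\<Sum>e'\<in>UNIV. if e' = e then root_vec e' else 0)"
    unfolding boundary_def by (intro sum.cong) (auto simp: axis_def)
  then show ?thesis by simp
qed

lemma boundary_nth: "boundary x $ v = (\<Sum>e | fst e = v. x $ e) - (\<Sum>e | snd e = v. x $ e)"
  by (simp add: boundary_def root_vec_nth right_diff_distrib sum_subtractf sum.If_cases
      if_distrib[of "(*) _"] Collect_conj_eq eq_commute[of v] cong: if_cong)

lemma outflow_eq:
  assumes "\<And>e. e \<notin> A \<Longrightarrow> x $ e = 0"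
  shows "outflow A x v = (\<Sum>e | fst e = v. x $ e)"
  unfolding outflow_def using assms by (intro sum.mono_neutral_left) auto

lemma inflow_eq:
  assumes "\<And>e. e \<notin> A \<Longrightarrow> x $ e = 0"
  shows "inflow A x v = (\<Sum>e | snd e = v. x $ e)"
  unfolding inflow_def using assms by (intro sum.mono_neutral_left) auto

lemma inner_edge_in_aug_graph [simp]: "inner_edge e \<in> aug_graph E \<longleftrightarrow> e \<in> E"
proof -
  have "inner_edge e \<in> aug_graph E \<longleftrightarrow> inner_edge e \<in> inner_edge ` E"
    by (auto simp: aug_graph_def inner_edge_def)
  then show ?thesis by auto
qed

lemma source_sink_edges_in_aug_graph [simp]:
  "(Source, Inner i) \<in> aug_graph E" "(Inner i, Sink) \<in> aug_graph E"
  by (auto simp: aug_graph_def)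

lemma not_in_aug_graph [simp]:
  "(v, Source) \<notin> aug_graph E" "(Sink, v) \<notin> aug_graph E" "(Source, Sink) \<notin> aug_graph E"
  by (auto simp: aug_graph_def inner_edge_def)

lemma all_aug_vertex: "(\<forall>v. P v) \<longleftrightarrow> P Source \<and> P Sink \<and> (\<forall>i. P (Inner i))"
  by (metis aug_vertex.exhaust)

text \<open>No edge enters \<open>Source\<close> and none leaves \<open>Sink\<close>, so the two
  normalisations and the conservation laws are the coordinates of one linear equation.\<close>

lemma flow_polytope_iff:
  "x \<in> flow_polytope E \<longleftrightarrow>
     (\<forall>e. e \<notin> aug_graph E \<longrightarrow> x $ e = 0) \<and> (\<forall>e. 0 \<le> x $ e) \<and>
     boundary x = root_vec (Source, Sink)"
proof (cases "\<forall>e. e \<notin> aug_graph E \<longrightarrow> x $ e = 0")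
  case True
  let ?A = "aug_graph E"
  have flows: "outflow ?A x v = (\<Sum>e | fst e = v. x $ e)" "inflow ?A x v = (\<Sum>e | snd e = v. x $ e)" for v
    using True outflow_eq[of ?A x] inflow_eq[of ?A x] by blast+
  have "inflow ?A x Source = 0" "outflow ?A x Sink = 0"
    unfolding inflow_def outflow_def by (auto intro!: sum.neutral simp: True)
  then have "boundary x = root_vec (Source, Sink) \<longleftrightarrow>
      outflow ?A x Source = 1 \<and> inflow ?A x Sink = 1 \<and>
      (\<forall>i. inflow ?A x (Inner i) = outflow ?A x (Inner i))"
    unfolding vec_eq_iff
    by (subst all_aug_vertex) (auto simp: boundary_nth root_vec_nth simp flip: flows)
  moreover have "(\<forall>e\<in>?A. 0 \<le> x $ e) \<longleftrightarrow> (\<forall>e. 0 \<le> x $ e)"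
    using True by (metis order_refl)
  ultimately show ?thesis
    using True by (auto simp: flow_polytope_def)
qed (auto simp: flow_polytope_def)

lemma flow_polytopeD:
  assumes "x \<in> flow_polytope E"
  shows "e \<notin> aug_graph E \<Longrightarrow> x $ e = 0" and "0 \<le> x $ e" and "boundary x = root_vec (Source, Sink)"
    and "e' \<notin> E \<Longrightarrow> x $ inner_edge e' = 0"
  using assms inner_edge_in_aug_graph[of e' E] unfolding flow_polytope_iff by blast+

text \<open>For a flow the left-hand sides are \<open>0\<close> and \<open>1\<close>. Hence
  \<open>root_map\<close> records what each vertex receives from \<open>Source\<close> minus what it
  sends to \<open>Sink\<close>, with total supply \<open>1\<close>.\<close>

lemma boundary_components:
  assumes "\<And>e. e \<notin> aug_graph E \<Longrightarrow> x $ e = 0"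
  shows "boundary x $ Inner i = root_map E x $ i + x $ (Inner i, Sink) - x $ (Source, Inner i)"
    and "boundary x $ Source = (\<Sum>i\<in>UNIV. x $ (Source, Inner i))"
proof -
  let ?S = "range (\<lambda>i. (Source, Inner i))" and ?T = "range (\<lambda>i. (Inner i, Sink))"
  have A: "aug_graph E = inner_edge ` E \<union> (?S \<union> ?T)"
    by (auto simp: aug_graph_def)
  have "boundary x = (\<Sum>e\<in>aug_graph E. x $ e *\<^sub>R root_vec e)"
    unfolding boundary_def using assms by (intro sum.mono_neutral_right) auto
  also have "\<dots> = (\<Sum>e\<in>inner_edge ` E. x $ e *\<^sub>R root_vec e) +
      ((\<Sum>e\<in>?S. x $ e *\<^sub>R root_vec e) + (\<Sum>e\<in>?T. x $ e *\<^sub>R root_vec e))"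
    unfolding A by (subst sum.union_disjoint sum.union_disjoint; auto simp: inner_edge_def)+
  also have "\<dots> = (\<Sum>e\<in>E. x $ inner_edge e *\<^sub>R root_vec (inner_edge e)) +
      ((\<Sum>i\<in>UNIV. x $ (Source, Inner i) *\<^sub>R root_vec (Source, Inner i)) +
       (\<Sum>i\<in>UNIV. x $ (Inner i, Sink) *\<^sub>R root_vec (Inner i, Sink)))"
    by (simp add: sum.reindex inj_on_def)
  finally have b: "boundary x = \<dots>" .
  show "boundary x $ Inner i = root_map E x $ i + x $ (Inner i, Sink) - x $ (Source, Inner i)"
    by (simp add: b root_map_def root_vec_nth inner_edge_def sum.delta' sum_negf
        if_distrib[of "(*) _"] cong: if_cong)
  show "boundary x $ Source = (\<Sum>i\<in>UNIV. x $ (Source, Inner i))"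
    by (simp add: b root_vec_nth inner_edge_def)
qed

text \<open>The coefficients become a unit flow once one unit is led from \<open>Source\<close> to
  \<open>u\<close> and from \<open>v\<close> to \<open>Sink\<close>. The case \<open>u = v\<close>
  is included and later yields the origin.\<close>

lemma ex_flow:
  assumes c: "\<And>e. e \<in> E \<Longrightarrow> 0 \<le> c e" and "(\<Sum>e\<in>E. c e *\<^sub>R root_vec e) = root_vec (u, v)"
  obtains x where "x \<in> flow_polytope E" "\<And>e. e \<in> E \<Longrightarrow> x $ inner_edge e = c e"
proof -
  define y :: "'a flow_space" where "y = (\<Sum>e\<in>E. c e *\<^sub>R axis (inner_edge e) 1)"
  define x where "x = y + axis (Source, Inner u) 1 + axis (Inner v, Sink) 1"
  have y_nonneg: "0 \<le> y $ e" for e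
    using c by (auto simp: y_def axis_def intro!: sum_nonneg)
  have y_inner: "y $ inner_edge e = c e" if "e \<in> E" for e
  proof -
    have "y $ inner_edge e = (\<Sum>e'\<in>E. if e' = e then c e' else 0)"
      unfolding y_def sum_component by (intro sum.cong) (auto simp: axis_def)
    then show ?thesis using that by simp
  qed
  have y_outside: "y $ e = 0" if "e \<notin> inner_edge ` E" for e
    using that by (auto simp: y_def axis_def intro!: sum.neutral)
  have "boundary x = (\<Sum>e\<in>E. c e *\<^sub>R root_vec (inner_edge e)) +
      root_vec (Source, Inner u) + root_vec (Inner v, Sink)"
    by (simp add: x_def y_def linear_add[OF linear_boundary] linear_sum[OF linear_boundary]
        linear_scale[OF linear_boundary] boundary_axis)
  also have "(\<Sum>e\<in>E. c e *\<^sub>R root_vec (inner_edge e)) = root_vec (Inner u, Inner v)"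
  proof -
    have "(\<Sum>e\<in>E. c e *\<^sub>R root_vec e) $ i = root_vec (u, v) $ i" for i
      using assms(2) by simp
    then have "(\<Sum>e\<in>E. c e *\<^sub>R root_vec (inner_edge e)) $ w = root_vec (Inner u, Inner v) $ w" for w
      by (cases w) (simp_all add: root_vec_nth inner_edge_def)
    then show ?thesis by (simp add: vec_eq_iff)
  qed
  finally have "boundary x = root_vec (Source, Sink)"
    by (simp add: root_vec_def)
  moreover have "0 \<le> x $ e" for e
    using y_nonneg[of e] by (simp add: x_def axis_def)
  moreover have "x $ e = 0" if "e \<notin> aug_graph E" for e
  proof -
    have "e \<notin> inner_edge ` E" "e \<noteq> (Source, Inner u)" "e \<noteq> (Inner v, Sink)"
      using that by auto
    then show ?thesis by (simp add: x_def y_outside axis_def)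
  qed
  ultimately have "x \<in> flow_polytope E"
    by (simp add: flow_polytope_iff)
  moreover have "x $ inner_edge e = c e" if "e \<in> E" for e
    using y_inner[OF that] by (simp add: x_def axis_def inner_edge_def)
  ultimately show thesis by (rule that)
qed

text \<open>Linear equations and inequalities give a polyhedron. It is bounded because edges go
  upwards in the vertex order, so that no flow can circulate.\<close>

lemma polytope_flow_polytope:
  fixes E :: "'v::{finite, linorder} graph"
  assumes "simple_graph E"
  shows "polytope (flow_polytope E)"
proof -
  let ?A = "{x. (\<forall>e. e \<notin> aug_graph E \<longrightarrow> x $ e = 0) \<and> boundary x = root_vec (Source, Sink)}"
  let ?N = "\<Inter>e. {x :: 'v flow_space. 0 \<le> axis e 1 \<bullet> x}"
  have "affine ?A"
    unfolding affine_def
    by (auto simp: linear_add[OF linear_boundary] linear_scale[OF linear_boundary]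
        simp flip: scaleR_add_left)
  then have "polyhedron ?A" by (rule affine_imp_polyhedron)
  moreover have "polyhedron ?N"
    by (intro polyhedron_Inter) (auto intro: polyhedron_halfspace_ge)
  ultimately have "polyhedron (?A \<inter> ?N)" by (rule polyhedron_Int)
  moreover have "?A \<inter> ?N = flow_polytope E"
    by (auto simp: flow_polytope_iff inner_axis')
  moreover have "bounded (flow_polytope E)"
  proof -
    text \<open>A potential dropping by at least 1 along every edge bounds the total amount of flow.\<close>
    define \<pi> :: "'v aug_vertex \<Rightarrow> real" where "\<pi> v = (case v of Source \<Rightarrow> CARD('v) + 1
        | Inner i \<Rightarrow> card {j. i \<le> j} | Sink \<Rightarrow> 0)" for v
    have rank: "card {j. i \<le> j} \<le> CARD('v)" "0 < card {j. i \<le> j}" for i :: 'v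
      by (auto intro!: card_mono simp: card_gt_0_iff)
    have less: "card {l. j \<le> l} < card {l. i \<le> l}" if "i < j" for i j :: 'v
    proof (rule psubset_card_mono)
      have "{l. j \<le> l} \<subseteq> {l. i \<le> l}" "i \<in> {l. i \<le> l}" "i \<notin> {l. j \<le> l}"
        using that by auto
      then show "{l. j \<le> l} \<subset> {l. i \<le> l}" by blast
    qed simp
    have drop: "1 \<le> \<pi> (fst e) - \<pi> (snd e)" if "e \<in> aug_graph E" for e
      using that unfolding aug_graph_def
    proof (elim UnE imageE CollectE exE conjE)
      fix e' assume e': "e = inner_edge e'" "e' \<in> E"
      then have "fst e' < snd e'" using assms by (auto simp: simple_graph_def)
      from less[OF this] show ?thesis
        by (simp add: e' inner_edge_def \<pi>_def)
    next
      fix i assume "e = (Source, Inner i)"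
      then show ?thesis using rank(1)[of i] by (simp add: \<pi>_def)
    next
      fix i assume "e = (Inner i, Sink)"
      then show ?thesis using rank(2)[of i] by (simp add: \<pi>_def)
    qed
    have "norm x \<le> CARD('v) + 1" if x: "x \<in> flow_polytope E" for x
    proof -
      have supp: "x $ e = 0" if "e \<notin> aug_graph E" for e
        using flow_polytopeD(1)[OF x that] .
      have nonneg: "0 \<le> x $ e" for e
        using flow_polytopeD(2)[OF x] .
      have bd: "boundary x = root_vec (Source, Sink)"
        using flow_polytopeD(3)[OF x] .
      have root: "(\<Sum>v\<in>UNIV. \<pi> v * root_vec e $ v) = \<pi> (fst e) - \<pi> (snd e)" for e
        by (simp add: root_vec_nth right_diff_distrib sum_subtractf if_distrib[of "(*) _"] cong: if_cong)
      have "norm x \<le> (\<Sum>e\<in>UNIV. \<bar>x $ e\<bar>)" by (rule norm_le_l1_cart)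
      also have "\<dots> \<le> (\<Sum>e\<in>UNIV. x $ e * (\<pi> (fst e) - \<pi> (snd e)))"
      proof (rule sum_mono)
        fix e
        show "\<bar>x $ e\<bar> \<le> x $ e * (\<pi> (fst e) - \<pi> (snd e))"
          using supp[of e] nonneg[of e] drop[of e] mult_left_mono[of 1 "\<pi> (fst e) - \<pi> (snd e)" "x $ e"]
          by (cases "e \<in> aug_graph E") auto
      qed
      also have "\<dots> = (\<Sum>e\<in>UNIV. \<Sum>v\<in>UNIV. x $ e * (\<pi> v * root_vec e $ v))"
        by (simp add: root flip: sum_distrib_left)
      \<comment> \<open>Exchanging the sums pairs the potential with the boundary, so the total is
        the drop from \<open>Source\<close> to \<open>Sink\<close>.\<close>
      also have "\<dots> = (\<Sum>v\<in>UNIV. \<pi> v * boundary x $ v)"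
        by (subst sum.swap) (simp add: boundary_def sum_distrib_left mult_ac)
      also have "\<dots> = CARD('v) + 1"
        unfolding bd root by (simp add: \<pi>_def)
      finally show ?thesis .
    qed
    then show ?thesis unfolding bounded_iff by blast
  qed
  ultimately show ?thesis
    by (simp add: polytope_eq_bounded_polyhedron)
qed

section \<open>Root polytopes as images of flow polytopes\<close>

lemma root_coneI:
  assumes "x = (\<Sum>e\<in>E. c e *\<^sub>R root_vec e)" "\<And>e. e \<in> E \<Longrightarrow> 0 \<le> c e"
  shows "x \<in> root_cone E"
  using assms unfolding root_cone_def by blast

lemma root_cone_mono:
  fixes E F :: "'v::finite graph"
  assumes "F \<subseteq> E"
  shows "root_cone F \<subseteq> root_cone E"
proof
  fix x assume "x \<in> root_cone F"
  then obtain c where c: "\<forall>e\<in>F. 0 \<le> c e" and x: "x = (\<Sum>e\<in>F. c e *\<^sub>R root_vec e)"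
    by (auto simp: root_cone_def)
  have "x = (\<Sum>e\<in>E. (if e \<in> F then c e else 0) *\<^sub>R root_vec e)"
    unfolding x using assms by (intro sum.mono_neutral_cong_left) auto
  then show "x \<in> root_cone E"
    by (rule root_coneI) (use c in auto)
qed

lemma root_cone_add:
  assumes "x \<in> root_cone E" "y \<in> root_cone E"
  shows "x + y \<in> root_cone E"
proof -
  obtain c d where c: "\<forall>e\<in>E. 0 \<le> c e" "x = (\<Sum>e\<in>E. c e *\<^sub>R root_vec e)"
    and d: "\<forall>e\<in>E. 0 \<le> d e" "y = (\<Sum>e\<in>E. d e *\<^sub>R root_vec e)"
    using assms by (auto simp: root_cone_def)
  have "x + y = (\<Sum>e\<in>E. (c e + d e) *\<^sub>R root_vec e)"
    by (simp add: c d scaleR_add_left sum.distrib)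
  then show ?thesis
    by (rule root_coneI) (use c d in auto)
qed

lemma zero_in_root_cone: "0 \<in> root_cone E"
  by (rule root_coneI[where c = "\<lambda>_. 0"]) auto

lemma root_vec_in_root_cone:
  fixes E :: "'v::finite graph"
  assumes "e \<in> E"
  shows "root_vec e \<in> root_cone E"
proof -
  have "root_vec e = (\<Sum>e'\<in>E. if e' = e then root_vec e' else 0)"
    using assms by simp
  also have "\<dots> = (\<Sum>e'\<in>E. (if e' = e then 1 else 0) *\<^sub>R root_vec e')"
    by (intro sum.cong) auto
  finally show ?thesis
    by (rule root_coneI) simp
qed

text \<open>
  Decomposition of a flow into paths: \<open>T u v\<close> is the amount travelling from \<open>u\<close> to \<open>v\<close>.  By induction
  on the edge set, removing an edge \<open>(u, v)\<close> whose tail is maximal: no edge leaves \<open>v\<close>, so the flow on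
  it can be charged to the amount absorbed at \<open>v\<close>.
\<close>

lemma transport:
  fixes E :: "'v::{finite, linorder} graph"
  assumes "simple_graph E" "\<And>e. e \<in> E \<Longrightarrow> 0 \<le> c e" "\<And>v. 0 \<le> s v" "\<And>v. 0 \<le> t v"
    and "\<And>v. s v - t v = (\<Sum>e\<in>E. c e * root_vec e $ v)"
  shows "\<exists>T. (\<forall>u v. 0 \<le> T u v) \<and> (\<forall>u. (\<Sum>v\<in>UNIV. T u v) = s u) \<and> (\<forall>v. (\<Sum>u\<in>UNIV. T u v) = t v) \<and>
    (\<forall>u v. T u v \<noteq> 0 \<longrightarrow> u \<le> v \<and> root_vec (u, v) \<in> root_cone E)"
  using assms
proof (induction "card E" arbitrary: E t)
  case 0
  then have "E = {}" by simp
  with 0 show ?case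
    by (intro exI[of _ "\<lambda>u v. if u = v then s u else 0"]) (auto simp: zero_in_root_cone)
next
  case (Suc n)
  have "E \<noteq> {}" using Suc.hyps(2) by auto
  then have "Max (fst ` E) \<in> fst ` E" by (intro Max_in) auto
  then obtain u v where uv: "(u, v) \<in> E" and "u = Max (fst ` E)" by force
  then have max: "a \<le> u" if "(a, b) \<in> E" for a b
    unfolding \<open>u = Max (fst ` E)\<close> using that by (intro Max_ge) force+
  have "u < v" using Suc.prems(1) uv by (auto simp: simple_graph_def)
  define q where "q = c (u, v)"
  have "0 \<le> q" using Suc.prems(2) uv by (simp add: q_def)
  \<comment> \<open>Without the edge, the \<open>q\<close> units that used it are absorbed at
    \<open>u\<close> instead of \<open>v\<close>.\<close>
  define t' where "t' w = t w + q * root_vec (u, v) $ w" for w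
  have split: "(\<Sum>e\<in>E. c e * root_vec e $ w) =
      q * root_vec (u, v) $ w + (\<Sum>e\<in>E - {(u, v)}. c e * root_vec e $ w)" for w
    using uv by (simp add: sum.remove q_def)
  \<comment> \<open>No edge starts at \<open>v\<close>, so the other edges contribute only inflow
    there. This gives \<open>q \<le> t v\<close>, hence \<open>t'\<close> is nonnegative.\<close>
  have "(\<Sum>e\<in>E - {(u, v)}. c e * root_vec e $ v) \<le> 0"
  proof (intro sum_nonpos)
    fix e assume "e \<in> E - {(u, v)}"
    then have "fst e \<noteq> v" "0 \<le> c e"
      using max[of "fst e" "snd e"] \<open>u < v\<close> Suc.prems(2) by auto
    then show "c e * root_vec e $ v \<le> 0"
      by (simp add: root_vec_nth)
  qed
  moreover have "root_vec (u, v) $ v = - 1" using \<open>u < v\<close> by (simp add: root_vec_nth)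
  ultimately have "q \<le> t v"
    using Suc.prems(5)[of v] Suc.prems(3)[of v] split[of v] by simp
  then have t': "0 \<le> t' w" for w
    using Suc.prems(4)[of w] \<open>0 \<le> q\<close> by (auto simp: t'_def root_vec_nth)
  have "\<exists>T. (\<forall>a b. 0 \<le> T a b) \<and> (\<forall>a. (\<Sum>b\<in>UNIV. T a b) = s a) \<and> (\<forall>b. (\<Sum>a\<in>UNIV. T a b) = t' b) \<and>
    (\<forall>a b. T a b \<noteq> 0 \<longrightarrow> a \<le> b \<and> root_vec (a, b) \<in> root_cone (E - {(u, v)}))"
  proof (rule Suc.hyps(1))
    show "n = card (E - {(u, v)})" using Suc.hyps(2) uv by simp
    show "simple_graph (E - {(u, v)})" using Suc.prems(1) by (auto simp: simple_graph_def)
    show "s w - t' w = (\<Sum>e\<in>E - {(u, v)}. c e * root_vec e $ w)" for w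
      using Suc.prems(5)[of w] split[of w] by (simp add: t'_def)
  qed (use Suc.prems t' in auto)
  then obtain T where T: "\<And>a b. 0 \<le> T a b" "\<And>a. (\<Sum>b\<in>UNIV. T a b) = s a"
      "\<And>b. (\<Sum>a\<in>UNIV. T a b) = t' b"
    and supp: "\<And>a b. T a b \<noteq> 0 \<Longrightarrow> a \<le> b \<and> root_vec (a, b) \<in> root_cone (E - {(u, v)})"
    by blast
  have supp': "a \<le> b \<and> root_vec (a, b) \<in> root_cone E" if "T a b \<noteq> 0" for a b
    using supp[OF that] root_cone_mono[of "E - {(u, v)}" E] by auto
  \<comment> \<open>The share of the arrivals at \<open>u\<close> that is sent on to
    \<open>v\<close>. If \<open>t' u = 0\<close> then \<open>q = 0\<close> as well, and division by
    zero returns the correct value \<open>0\<close>.\<close>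
  define r where "r = q / t' u"
  have "t' u = t u + q" using \<open>u < v\<close> by (simp add: t'_def root_vec_nth)
  then have r: "0 \<le> r" "r \<le> 1" "r * t' u = q"
    using \<open>0 \<le> q\<close> Suc.prems(4)[of u] by (auto simp: r_def divide_le_eq_1)
  \<comment> \<open>As \<open>root_vec (u, v)\<close> is \<open>1\<close> at \<open>u\<close> and
    \<open>-1\<close> at \<open>v\<close>, the share \<open>r\<close> of each \<open>T a u\<close>
    moves to \<open>T a v\<close>, and the row sums stay the same.\<close>
  define T' where "T' a b = T a b - r * T a u * root_vec (u, v) $ b" for a b
  have "u \<noteq> v" using \<open>u < v\<close> by simp
  have le: "r * T a u \<le> T a u" for a
    using r T(1)[of a u] by (simp add: mult_left_le_one_le)
  have "0 \<le> T' a b" for a b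
  proof -
    have "0 \<le> r * T a u" using r(1) T(1) by simp
    then show ?thesis
      using le[of a] T(1)[of a b] \<open>u \<noteq> v\<close> by (auto simp: T'_def root_vec_nth)
  qed
  moreover have "(\<Sum>b\<in>UNIV. T' a b) = s a" for a
  proof -
    have "(\<Sum>b\<in>UNIV. root_vec (u, v) $ b) = 0"
      by (simp add: root_vec_nth sum_subtractf)
    then show ?thesis
      by (simp add: T'_def sum_subtractf T(2) flip: sum_distrib_left)
  qed
  moreover have "(\<Sum>a\<in>UNIV. T' a b) = t b" for b
    using r(3) by (simp add: T'_def sum_subtractf T(3) flip: sum_distrib_left sum_distrib_right)
      (simp add: t'_def)
  \<comment> \<open>Only pairs \<open>(a, v)\<close> fed from \<open>(a, u)\<close> can join the
    support, and their roots are sums of two vectors of the cone.\<close>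
  moreover have "a \<le> b \<and> root_vec (a, b) \<in> root_cone E" if "T' a b \<noteq> 0" for a b
  proof (cases "T a b = 0")
    case True
    then have "T a u \<noteq> 0" "b = u \<or> b = v"
      using that by (auto simp: T'_def root_vec_nth split: if_splits)
    with True have "b = v" and au: "a \<le> u" "root_vec (a, u) \<in> root_cone E"
      using supp'[of a u] by auto
    moreover have "root_vec (a, u) + root_vec (u, v) \<in> root_cone E"
      by (intro root_cone_add au root_vec_in_root_cone uv)
    ultimately show ?thesis using \<open>u < v\<close> by (simp add: root_vec_add)
  qed (rule supp')
  ultimately show ?case by blast
qed

text \<open>This makes \<open>root_map UNIV\<close> a common map for all graphs, so it need not
  change when a reduction changes the graph.\<close>

lemma root_map_UNIV_eq:
  fixes E :: "'v::finite graph"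
  assumes "\<And>e. e \<notin> aug_graph E \<Longrightarrow> x $ e = 0"
  shows "root_map UNIV x = root_map E x"
  unfolding root_map_def using assms by (intro sum.mono_neutral_right) auto

lemma convex_flow_polytope: "convex (flow_polytope E)"
proof (rule convexI)
  fix x y :: "'a flow_space" and a b :: real
  assume "x \<in> flow_polytope E" "y \<in> flow_polytope E" "0 \<le> a" "0 \<le> b" "a + b = 1"
  then show "a *\<^sub>R x + b *\<^sub>R y \<in> flow_polytope E"
    by (auto simp: flow_polytope_iff linear_add[OF linear_boundary] linear_scale[OF linear_boundary]
        simp flip: scaleR_add_left)
qed

text \<open>The image is convex, so it suffices that it contains the generators of the hull, which
  \<open>ex_flow\<close> provides. The other inclusion is the path decomposition of
  \<open>transport\<close>, whose amounts add up to \<open>1\<close>.\<close>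

lemma root_polytope_eq:
  fixes E :: "'v::{finite, linorder} graph"
  assumes "simple_graph E"
  shows "root_polytope E = root_map UNIV ` flow_polytope E"
proof
  have vertex: "root_vec (u, v) \<in> root_map UNIV ` flow_polytope E"
    if uv: "root_vec (u, v) \<in> root_cone E" for u v
  proof -
    obtain c where c: "\<And>e. e \<in> E \<Longrightarrow> 0 \<le> c e" "root_vec (u, v) = (\<Sum>e\<in>E. c e *\<^sub>R root_vec e)"
      using uv by (auto simp: root_cone_def)
    obtain x where x: "x \<in> flow_polytope E" "\<And>e. e \<in> E \<Longrightarrow> x $ inner_edge e = c e"
      using ex_flow[OF c(1) c(2)[symmetric]] by blast
    have "root_map UNIV x = root_map E x"
      by (intro root_map_UNIV_eq flow_polytopeD(1)[OF x(1)])
    also have "\<dots> = root_vec (u, v)"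
      using x(2) c(2) by (simp add: root_map_def)
    finally show ?thesis using x(1) by force
  qed
  show "root_polytope E \<subseteq> root_map UNIV ` flow_polytope E"
    unfolding root_polytope_def
  proof (rule hull_minimal)
    \<comment> \<open>The origin is the degenerate root of a pair \<open>(i, i)\<close>; any vertex
      serves, here \<open>undefined\<close>.\<close>
    have "0 \<in> root_map UNIV ` flow_polytope E"
      using vertex[of undefined undefined] by (simp add: zero_in_root_cone)
    then show "{0} \<union> positive_roots \<inter> root_cone E \<subseteq> root_map UNIV ` flow_polytope E"
      using vertex by (auto simp: positive_roots_def)
    show "convex (root_map UNIV ` flow_polytope E)"
      by (intro convex_linear_image linear_root_map convex_flow_polytope)
  qed
next
  show "root_map UNIV ` flow_polytope E \<subseteq> root_polytope E"
  proof (rule image_subsetI)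
    fix x assume x: "x \<in> flow_polytope E"
    have supp: "x $ e = 0" if "e \<notin> aug_graph E" for e
      using flow_polytopeD(1)[OF x that] .
    note b = boundary_components[of E x, OF supp]
    define s t where "s i = x $ (Source, Inner i)" and "t i = x $ (Inner i, Sink)" for i
    have nonneg: "0 \<le> x $ e" for e
      using flow_polytopeD(2)[OF x] .
    have bd: "boundary x = root_vec (Source, Sink)"
      using flow_polytopeD(3)[OF x] .
    have st: "s i - t i = root_map E x $ i" for i
      using b(1)[of i] by (simp add: bd root_vec_nth s_def t_def)
    have "\<exists>T. (\<forall>u v. 0 \<le> T u v) \<and> (\<forall>u. (\<Sum>v\<in>UNIV. T u v) = s u) \<and>
        (\<forall>v. (\<Sum>u\<in>UNIV. T u v) = t v) \<and>
        (\<forall>u v. T u v \<noteq> 0 \<longrightarrow> u \<le> v \<and> root_vec (u, v) \<in> root_cone E)"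
    proof (rule transport[OF assms, of "\<lambda>e. x $ inner_edge e"])
      show "s i - t i = (\<Sum>e\<in>E. x $ inner_edge e * root_vec e $ i)" for i
        by (simp add: st root_map_def)
    qed (simp_all add: nonneg s_def t_def)
    then obtain T where T: "\<And>u v. 0 \<le> T u v" "\<And>u. (\<Sum>v\<in>UNIV. T u v) = s u"
        "\<And>v. (\<Sum>u\<in>UNIV. T u v) = t v"
      and Tsupp: "\<And>u v. T u v \<noteq> 0 \<Longrightarrow> u \<le> v \<and> root_vec (u, v) \<in> root_cone E"
      by blast
    \<comment> \<open>A pair carrying no amount may have its root outside the cone; replacing that
      root by \<open>0\<close> leaves the weighted sum unchanged.\<close>
    define y where "y p = (if T (fst p) (snd p) = 0 then 0 else root_vec p)" for p
    have "(\<Sum>p\<in>UNIV. T (fst p) (snd p) *\<^sub>R y p) \<in> root_polytope E"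
      unfolding root_polytope_def
    proof (rule convex_sum)
      have "(\<Sum>p\<in>UNIV. T (fst p) (snd p)) = (\<Sum>u\<in>UNIV. \<Sum>v\<in>UNIV. T u v)"
        by (simp add: sum.cartesian_product case_prod_beta)
      also have "\<dots> = 1"
        using b(2) by (simp add: T(2) bd root_vec_nth s_def)
      finally show "(\<Sum>p\<in>UNIV. T (fst p) (snd p)) = 1" .
      fix p :: "'v \<times> 'v"
      show "y p \<in> convex hull ({0} \<union> positive_roots \<inter> root_cone E)"
      proof (rule hull_inc)
        have "y p \<in> positive_roots \<inter> root_cone E" if "y p \<noteq> 0"
        proof -
          obtain u v where p: "p = (u, v)" by (cases p)
          have "T u v \<noteq> 0" "u \<noteq> v" "y p = root_vec (u, v)"
            using that by (auto simp: y_def p split: if_splits)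
          moreover have "u < v" "root_vec (u, v) \<in> root_cone E"
            using Tsupp[OF \<open>T u v \<noteq> 0\<close>] \<open>u \<noteq> v\<close> by auto
          ultimately show ?thesis
            by (auto simp: positive_roots_def)
        qed
        then show "y p \<in> {0} \<union> positive_roots \<inter> root_cone E" by blast
      qed
    qed (simp_all add: T)
    also have "(\<Sum>p\<in>UNIV. T (fst p) (snd p) *\<^sub>R y p) =
        (\<Sum>p\<in>UNIV. T (fst p) (snd p) *\<^sub>R root_vec p)"
      by (intro sum.cong) (auto simp: y_def)
    also have "\<dots> = root_map E x"
    proof (rule vec_eq_iff[THEN iffD2], rule allI)
      fix i
      have "(\<Sum>p\<in>UNIV. T (fst p) (snd p) *\<^sub>R root_vec p) $ i =
          (\<Sum>u\<in>UNIV. \<Sum>v\<in>UNIV. T u v * root_vec (u, v) $ i)"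
        by (simp add: sum.cartesian_product case_prod_beta)
      also have "\<dots> = (\<Sum>u\<in>UNIV. \<Sum>v\<in>UNIV. if u = i then T u v else 0) -
          (\<Sum>u\<in>UNIV. \<Sum>v\<in>UNIV. if v = i then T u v else 0)"
        unfolding sum_subtractf[symmetric]
        by (intro sum.cong) (auto simp: root_vec_nth)
      also have "(\<Sum>u\<in>UNIV. \<Sum>v\<in>UNIV. if u = i then T u v else 0) = s i"
        by (subst sum.swap) (simp add: T(2))
      also have "(\<Sum>u\<in>UNIV. \<Sum>v\<in>UNIV. if v = i then T u v else 0) = t i"
        by (simp add: T(3))
      finally show "(\<Sum>p\<in>UNIV. T (fst p) (snd p) *\<^sub>R root_vec p) $ i = root_map E x $ i"
        by (simp add: st)
    qed
    also have "\<dots> = root_map UNIV x"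
      using root_map_UNIV_eq[OF supp] by simp
    finally show "root_map UNIV x \<in> root_polytope E" .
  qed
qed

text \<open>The span is a coordinate subspace: its members vanish off the edges of \<open>E\<close>,
  and orthogonality to each coordinate vector fixes the remaining coordinates.\<close>

lemma proj_map_nth: "proj_map E x $ e = (if e \<in> inner_edge ` E then x $ e else 0)"
proof -
  let ?W = "edge_subspace E"
  have W: "proj_map E x \<in> ?W" "\<And>w. w \<in> ?W \<Longrightarrow> orthogonal (x - proj_map E x) w"
    using orth_proj_works[of ?W x] by (auto simp: proj_map_def edge_subspace_def)
  have "?W \<subseteq> {y. \<forall>e. e \<notin> inner_edge ` E \<longrightarrow> y $ e = 0}"
    unfolding edge_subspace_def
    by (rule span_minimal) (auto simp: subspace_def axis_def)
  with W(1) have "e \<notin> inner_edge ` E \<Longrightarrow> proj_map E x $ e = 0" by blast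
  moreover have "proj_map E x $ inner_edge e' = x $ inner_edge e'" if "e' \<in> E" for e'
  proof -
    have "axis (inner_edge e') 1 \<in> ?W"
      unfolding edge_subspace_def using that by (intro span_base) blast
    from W(2)[OF this] show ?thesis
      by (simp add: orthogonal_def inner_axis)
  qed
  ultimately show ?thesis by auto
qed

lemma proj_map_in_edge_subspace: "proj_map E x \<in> edge_subspace E"
  using orth_proj_works[of "edge_subspace E" x] by (simp add: proj_map_def edge_subspace_def)

lemma root_map_proj_map: "root_map E (proj_map E x) = root_map E x"
  by (simp add: root_map_def proj_map_nth)

section \<open>Reductions\<close>

lemma linear_reroute: "linear (reroute i j k)"
  by (rule linearI) (auto simp: reroute_def algebra_simps)

lemma root_map_reroute: "root_map UNIV (reroute i j k x) = root_map UNIV x"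
proof -
  note l = linear_root_map[of UNIV]
  show ?thesis
    by (simp add: reroute_def linear_add[OF l] linear_diff[OF l] linear_scale[OF l] root_map_axis
        root_vec_add)
qed

lemma boundary_reroute: "boundary (reroute i j k x) = boundary x"
  by (simp add: reroute_def linear_add[OF linear_boundary] linear_diff[OF linear_boundary]
      linear_scale[OF linear_boundary] boundary_axis inner_edge_def root_vec_add)

lemma reroute_nth: "reroute i j k x $ e = x $ e + x $ inner_edge (i, k) *
    ((if e = inner_edge (i, j) then 1 else 0) + (if e = inner_edge (j, k) then 1 else 0) -
     (if e = inner_edge (i, k) then 1 else 0))"
  by (simp add: reroute_def axis_def)

context
  fixes H H' :: "'v::{finite, linorder} graph" and i j k :: 'v
  assumes lt: "i < j" "j < k" and H: "(i, j) \<in> H" "(j, k) \<in> H" "(i, k) \<notin> H"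
    and H': "insert (i, k) (H - {(i, j), (j, k)}) \<subseteq> H'" "H' \<subseteq> insert (i, k) H"
    and not_both: "(i, j) \<notin> H' \<or> (j, k) \<notin> H'"
begin

lemma vertices_distinct: "i \<noteq> j" "j \<noteq> i" "j \<noteq> k" "k \<noteq> j" "i \<noteq> k" "k \<noteq> i"
  using lt less_trans[OF lt] by auto

text \<open>Here \<open>H'\<close> stands for any of the three reducts. At whichever of
  \<open>(i, j)\<close>, \<open>(j, k)\<close> is missing from \<open>H'\<close>, the rerouted
  vector shows exactly the flow on \<open>(i, k)\<close>, and this determines the rest.\<close>

lemma inj_on_reroute: "inj_on (reroute i j k) (flow_polytope H')"
proof (rule inj_onI)
  fix x y assume x: "x \<in> flow_polytope H'" and y: "y \<in> flow_polytope H'"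
    and eq: "reroute i j k x = reroute i j k y"
  have "x $ inner_edge (i, k) = y $ inner_edge (i, k)"
    using not_both
  proof
    assume "(i, j) \<notin> H'"
    then show ?thesis
      using arg_cong[OF eq, of "\<lambda>z. z $ inner_edge (i, j)"] vertices_distinct
        flow_polytopeD(4)[OF x] flow_polytopeD(4)[OF y]
      by (simp add: reroute_nth)
  next
    assume "(j, k) \<notin> H'"
    then show ?thesis
      using arg_cong[OF eq, of "\<lambda>z. z $ inner_edge (j, k)"] vertices_distinct
        flow_polytopeD(4)[OF x] flow_polytopeD(4)[OF y]
      by (simp add: reroute_nth)
  qed
  with eq show "x = y" by (simp add: reroute_def)
qed

text \<open>A missing edge carries only the flow rerouted from \<open>(i, k)\<close>, hence at most
  as much as the other edge of the path.\<close>

lemma reroute_flow_polytope: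
  "reroute i j k ` flow_polytope H' = {y \<in> flow_polytope H.
     ((i, j) \<notin> H' \<longrightarrow> y $ inner_edge (i, j) \<le> y $ inner_edge (j, k)) \<and>
     ((j, k) \<notin> H' \<longrightarrow> y $ inner_edge (j, k) \<le> y $ inner_edge (i, j))}"
    (is "_ = ?R")
proof (intro subset_antisym image_subsetI subsetI)
  fix x assume x: "x \<in> flow_polytope H'"
  have nonneg: "0 \<le> x $ e" for e
    using flow_polytopeD(2)[OF x] .
  let ?y = "reroute i j k x"
  have "?y $ e = 0" if "e \<notin> aug_graph H" for e
  proof (cases "e = inner_edge (i, k)")
    case False
    have "e \<notin> aug_graph H'"
      using that False H'(2) by (auto simp: aug_graph_def)
    then have "x $ e = 0" using flow_polytopeD(1)[OF x] by blast
    moreover have "e \<noteq> inner_edge (i, j)" "e \<noteq> inner_edge (j, k)"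
      using that H by auto
    ultimately show ?thesis using False by (simp add: reroute_nth)
  qed (use vertices_distinct in \<open>simp add: reroute_nth\<close>)
  moreover have "0 \<le> ?y $ e" for e
    using nonneg[of e] nonneg[of "inner_edge (i, k)"] vertices_distinct by (auto simp: reroute_nth)
  moreover have "boundary ?y = root_vec (Source, Sink)"
    using flow_polytopeD(3)[OF x] by (simp add: boundary_reroute)
  ultimately have "?y \<in> flow_polytope H"
    unfolding flow_polytope_iff by blast
  moreover have "?y $ inner_edge (i, j) = x $ inner_edge (i, j) + x $ inner_edge (i, k)"
    "?y $ inner_edge (j, k) = x $ inner_edge (j, k) + x $ inner_edge (i, k)"
    using vertices_distinct by (simp_all add: reroute_nth)
  ultimately show "?y \<in> ?R"
    using nonneg flow_polytopeD(4)[OF x] by simp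
next
  fix y assume "y \<in> ?R"
  then have y: "y \<in> flow_polytope H"
    and ij: "(i, j) \<notin> H' \<longrightarrow> y $ inner_edge (i, j) \<le> y $ inner_edge (j, k)"
    and jk: "(j, k) \<notin> H' \<longrightarrow> y $ inner_edge (j, k) \<le> y $ inner_edge (i, j)"
    by auto
  have nonneg: "0 \<le> y $ e" for e
    using flow_polytopeD(2)[OF y] .
  have ik: "y $ inner_edge (i, k) = 0"
    using flow_polytopeD(4)[OF y H(3)] .
  \<comment> \<open>The inverse pulls as much back onto \<open>(i, k)\<close> as nonnegativity
    permits; by \<open>ij\<close> and \<open>jk\<close> this empties whichever of the two edges is
    missing from \<open>H'\<close>.\<close>
  define m where "m = min (y $ inner_edge (i, j)) (y $ inner_edge (j, k))"
  define x where "x = y - m *\<^sub>R (axis (inner_edge (i, j)) 1 + axis (inner_edge (j, k)) 1 -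
      axis (inner_edge (i, k)) 1)"
  have x_nth: "x $ e = y $ e - m * ((if e = inner_edge (i, j) then 1 else 0) +
      (if e = inner_edge (j, k) then 1 else 0) - (if e = inner_edge (i, k) then 1 else 0))" for e
    by (simp add: x_def axis_def)
  have "x $ inner_edge (i, k) = m"
    using vertices_distinct ik by (simp add: x_nth)
  then have "reroute i j k x = y"
    by (simp add: reroute_def x_def)
  moreover have "x \<in> flow_polytope H'"
    unfolding flow_polytope_iff
  proof (intro conjI allI impI)
    show "0 \<le> x $ e" for e
      using nonneg[of e] nonneg[of "inner_edge (i, j)"] nonneg[of "inner_edge (j, k)"] vertices_distinct
      by (auto simp: x_nth m_def)
    show "boundary x = root_vec (Source, Sink)"
      using flow_polytopeD(3)[OF y] boundary_reroute[of i j k x] \<open>reroute i j k x = y\<close>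
      by simp
    fix e assume e: "e \<notin> aug_graph H'"
    consider "e = inner_edge (i, j)" | "e = inner_edge (j, k)"
      | "e \<noteq> inner_edge (i, j)" "e \<noteq> inner_edge (j, k)" by blast
    then show "x $ e = 0"
    proof cases
      case 1
      then show ?thesis using e ij vertices_distinct by (simp add: x_nth m_def)
    next
      case 2
      then show ?thesis using e jk vertices_distinct by (simp add: x_nth m_def)
    next
      case 3
      then have "e \<notin> aug_graph H" "e \<noteq> inner_edge (i, k)"
        using e H'(1) by (auto simp: aug_graph_def)
      then show ?thesis
        using 3 flow_polytopeD(1)[OF y] by (simp add: x_nth)
    qed
  qed
  ultimately show "y \<in> reroute i j k ` flow_polytope H'" by blast
qed

end

section \<open>The functional that cuts both polytopes\<close>

definition edge_difference :: "'v \<Rightarrow> 'v \<Rightarrow> 'v \<Rightarrow> 'v::finite flow_space \<Rightarrow> real" where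
  "edge_difference i j k x = x $ inner_edge (i, j) - x $ inner_edge (j, k)"

lemma linear_edge_difference: "linear (edge_difference i j k)"
  by (rule linearI) (auto simp: edge_difference_def algebra_simps)

text \<open>The flow runs from \<open>Source\<close> through \<open>e\<close> to
  \<open>Sink\<close>. Such flows supply points strictly on either side of the cut.\<close>

lemma ex_path_flow:
  fixes H :: "'v::{finite, linorder} graph"
  assumes "e \<in> H"
  obtains x where "x \<in> flow_polytope H" "x $ inner_edge e = 1"
    "\<And>e'. e' \<in> H \<Longrightarrow> e' \<noteq> e \<Longrightarrow> x $ inner_edge e' = 0"
proof -
  define c where "c e' = (if e' = e then 1 else 0 :: real)" for e'
  have "(\<Sum>e'\<in>H. c e' *\<^sub>R root_vec e') = (\<Sum>e'\<in>H. if e' = e then root_vec e' else 0)"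
    by (intro sum.cong) (auto simp: c_def)
  also have "\<dots> = root_vec (fst e, snd e)" using assms by simp
  finally obtain x where "x \<in> flow_polytope H" "\<And>e. e \<in> H \<Longrightarrow> x $ inner_edge e = c e"
    by (rule ex_flow[rotated]) (auto simp: c_def)
  then show thesis
    using that[of x] assms by (simp add: c_def)
qed

context
  fixes H :: "'v::{finite, linorder} graph" and i j k :: 'v
  assumes simple: "simple_graph H" and indep: "independent (root_vec ` H)"
    and ij: "(i, j) \<in> H" and jk: "(j, k) \<in> H"
begin

lemma edges_distinct: "i < j" "j < k" "(i, j) \<noteq> (j, k)" "(i, k) \<noteq> (i, j)" "(i, k) \<noteq> (j, k)"
  using simple ij jk by (auto simp: simple_graph_def)

text \<open>\<open>reduct1\<close> lacks \<open>(j, k)\<close>, \<open>reduct2\<close> lacks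
  \<open>(i, j)\<close> and \<open>reduct3\<close> lacks both, so the inequalities attached to
  missing edges become the three sign conditions.\<close>

lemma reroute_reducts:
  shows "reroute i j k ` flow_polytope (reduct1 i j k H) = {x \<in> flow_polytope H. edge_difference i j k x \<ge> 0}"
    and "reroute i j k ` flow_polytope (reduct2 i j k H) = {x \<in> flow_polytope H. edge_difference i j k x \<le> 0}"
    and "reroute i j k ` flow_polytope (reduct3 i j k H) = {x \<in> flow_polytope H. edge_difference i j k x = 0}"
    and "inj_on (reroute i j k) (flow_polytope (reduct1 i j k H))"
    and "inj_on (reroute i j k) (flow_polytope (reduct2 i j k H))"
proof -
  note inv = edges_distinct(1,2) ij jk reduct_invariants(1)[OF simple indep ij jk]
  note R = reroute_flow_polytope[OF inv] and I = inj_on_reroute[OF inv]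
  note mem = reduct1_def reduct2_def reduct3_def
  show "inj_on (reroute i j k) (flow_polytope (reduct1 i j k H))"
    using edges_distinct by (intro I) (auto simp: mem)
  show "inj_on (reroute i j k) (flow_polytope (reduct2 i j k H))"
    using edges_distinct by (intro I) (auto simp: mem)
  show "reroute i j k ` flow_polytope (reduct1 i j k H) = {x \<in> flow_polytope H. edge_difference i j k x \<ge> 0}"
    using edges_distinct ij by (subst R) (auto simp: mem edge_difference_def)
  show "reroute i j k ` flow_polytope (reduct2 i j k H) = {x \<in> flow_polytope H. edge_difference i j k x \<le> 0}"
    using edges_distinct jk by (subst R) (auto simp: mem edge_difference_def)
  show "reroute i j k ` flow_polytope (reduct3 i j k H) = {x \<in> flow_polytope H. edge_difference i j k x = 0}"
    using edges_distinct by (subst R) (auto simp: mem edge_difference_def)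
qed

lemma root_polytope_reroute:
  assumes "simple_graph H'"
  shows "root_polytope H' = root_map UNIV ` reroute i j k ` flow_polytope H'"
  unfolding root_polytope_eq[OF assms] image_image root_map_reroute ..

text \<open>
  By independence the edge difference is determined by the root map; this is what carries the
  subdivision of the flow polytope over to the root polytope.
\<close>

lemma ex_root_functional:
  obtains f where "linear f" "\<And>x. x \<in> flow_polytope H \<Longrightarrow> f (root_map UNIV x) = edge_difference i j k x"
proof -
  \<comment> \<open>These values pick out the coefficient of \<open>(i, j)\<close> minus that of
    \<open>(j, k)\<close>; independence allows a linear extension.\<close>
  define h :: "(real, 'v) vec \<Rightarrow> real" where
    "h y = (if y = root_vec (i, j) then 1 else if y = root_vec (j, k) then - 1 else 0)" for y
  obtain f where f: "linear f" "\<And>y. y \<in> root_vec ` H \<Longrightarrow> f y = h y"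
    using linear_independent_extend[OF indep, of h] by blast
  have f_root: "f (root_vec e) = (if e = (i, j) then 1 else 0) - (if e = (j, k) then 1 else 0)"
    if "e \<in> H" for e
    using that ij jk edges_distinct(3) inj_on_root_vec[OF simple]
    by (auto simp: f(2) h_def dest: inj_onD)
  have "f (root_map UNIV x) = edge_difference i j k x" if x: "x \<in> flow_polytope H" for x
  proof -
    have "f (root_map UNIV x) = (\<Sum>e\<in>H. x $ inner_edge e * f (root_vec e))"
      by (simp add: root_map_UNIV_eq[OF flow_polytopeD(1)[OF x]] root_map_def[of H]
          linear_sum[OF f(1)] linear_scale[OF f(1)])
    also have "\<dots> = (\<Sum>e\<in>H. if e = (i, j) then x $ inner_edge e else 0) -
        (\<Sum>e\<in>H. if e = (j, k) then x $ inner_edge e else 0)"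
      unfolding sum_subtractf[symmetric] by (intro sum.cong) (auto simp: f_root)
    also have "\<dots> = edge_difference i j k x"
      using ij jk by (simp add: edge_difference_def)
    finally show ?thesis .
  qed
  with f(1) show thesis by (rule that)
qed

lemma ex_positive_negative_flow:
  obtains p q where "p \<in> flow_polytope H" "edge_difference i j k p > 0"
    "q \<in> flow_polytope H" "edge_difference i j k q < 0"
proof -
  obtain p where p: "p \<in> flow_polytope H" "p $ inner_edge (i, j) = 1" "p $ inner_edge (j, k) = 0"
    using ex_path_flow[OF ij] jk edges_distinct(3) by metis
  obtain q where q: "q \<in> flow_polytope H" "q $ inner_edge (j, k) = 1" "q $ inner_edge (i, j) = 0"
    using ex_path_flow[OF jk] ij edges_distinct(3) by metis
  show thesis
    by (rule that[of p q]) (simp_all add: p q edge_difference_def)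
qed

lemma root_reducts:
  obtains f :: "(real, 'v) vec \<Rightarrow> real" and p q where "linear f"
    "root_polytope (reduct1 i j k H) = {y \<in> root_polytope H. f y \<ge> 0}"
    "root_polytope (reduct2 i j k H) = {y \<in> root_polytope H. f y \<le> 0}"
    "root_polytope (reduct3 i j k H) = {y \<in> root_polytope H. f y = 0}"
    "p \<in> root_polytope H" "f p > 0" "q \<in> root_polytope H" "f q < 0"
proof -
  obtain f where f: "linear f"
      "\<And>x. x \<in> flow_polytope H \<Longrightarrow> f (root_map UNIV x) = edge_difference i j k x"
    using ex_root_functional by blast
  obtain p q where pq: "p \<in> flow_polytope H" "edge_difference i j k p > 0"
      "q \<in> flow_polytope H" "edge_difference i j k q < 0"
    using ex_positive_negative_flow by blast
  note P = root_polytope_eq[OF simple]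
  \<comment> \<open>On flows, \<open>f\<close> after the root map is the edge difference, so any
    condition \<open>Q\<close> on the latter passes to the image as a condition on
    \<open>f\<close>.\<close>
  have pull: "root_map UNIV ` {x \<in> flow_polytope H. Q (edge_difference i j k x)} =
      {y \<in> root_polytope H. Q (f y)}" for Q
    unfolding P by (auto simp: f(2))
  note simple_reducts = reduct_invariants(2,4,6)[OF simple indep ij jk]
  show thesis
  proof (rule that[OF f(1)])
    show "root_polytope (reduct1 i j k H) = {y \<in> root_polytope H. f y \<ge> 0}"
      unfolding root_polytope_reroute[OF simple_reducts(1)] reroute_reducts
      by (rule pull[of "\<lambda>r. r \<ge> 0"])
    show "root_polytope (reduct2 i j k H) = {y \<in> root_polytope H. f y \<le> 0}"
      unfolding root_polytope_reroute[OF simple_reducts(2)] reroute_reducts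
      by (rule pull[of "\<lambda>r. r \<le> 0"])
    show "root_polytope (reduct3 i j k H) = {y \<in> root_polytope H. f y = 0}"
      unfolding root_polytope_reroute[OF simple_reducts(3)] reroute_reducts
      by (rule pull[of "\<lambda>r. r = 0"])
    show "root_map UNIV p \<in> root_polytope H" "f (root_map UNIV p) > 0"
      "root_map UNIV q \<in> root_polytope H" "f (root_map UNIV q) < 0"
      using pq by (simp_all add: P f(2))
  qed
qed

end

section \<open>The invariant of a reduction sequence\<close>

lemma polytope_root_polytope:
  "simple_graph E \<Longrightarrow> polytope (root_polytope E)"
  by (simp add: root_polytope_eq polytope_linear_image linear_root_map polytope_flow_polytope)

text \<open>
  The last condition says that rerouting does not change the image under the root map, so that
  \<open>f \<circ> p\<close> maps the flow piece of \<open>(H, \<phi>)\<close> onto the root polytope of \<open>H\<close>.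
\<close>

definition valid_piece :: "'v::{finite, linorder} graph \<Rightarrow> 'v graph \<times> ('v flow_space \<Rightarrow> 'v flow_space) \<Rightarrow> bool" where
  "valid_piece G = (\<lambda>(H, \<phi>). simple_graph H \<and> independent (root_vec ` H) \<and> linear \<phi> \<and>
     inj_on \<phi> (flow_polytope H) \<and> \<phi> ` flow_polytope H \<subseteq> flow_polytope G \<and>
     (\<forall>x. root_map UNIV (\<phi> x) = root_map UNIV x))"

lemma valid_piece_reroute:
  assumes "valid_piece G (H, \<phi>)" "simple_graph H'" "independent (root_vec ` H')"
    and "reroute i j k ` flow_polytope H' \<subseteq> flow_polytope H" "inj_on (reroute i j k) (flow_polytope H')"
  shows "valid_piece G (H', \<phi> \<circ> reroute i j k)"
  using assms unfolding valid_piece_def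
  by (auto simp: root_map_reroute intro!: linear_compose linear_reroute comp_inj_on
      intro: inj_on_subset)

text \<open>Both dissections are carried along together with the validity of every piece: cutting
  the next piece uses the independence of its roots and the injectivity of its embedding.\<close>

lemma reduction_state_invariant:
  fixes G :: "'v::{finite, linorder} graph"
  assumes "simple_graph G" "independent (root_vec ` G)" "reduction_state G D"
  shows "indexed_dissection D (\<lambda>(H, \<phi>). root_polytope H) (root_polytope G) \<and>
    indexed_dissection D (\<lambda>(H, \<phi>). \<phi> ` flow_polytope H) (flow_polytope G) \<and>
    (\<forall>d\<in>D. valid_piece G d)"
  using assms(3)
proof induction
  case start
  then show ?case
    using assms(1,2) linear_id
    by (auto simp: indexed_dissection_def valid_piece_def polytope_root_polytope
        polytope_flow_polytope id_def)
next
  case (reduce D H \<phi> i j k)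
  then have dissections: "indexed_dissection D (\<lambda>(H, \<phi>). root_polytope H) (root_polytope G)"
      "indexed_dissection D (\<lambda>(H, \<phi>). \<phi> ` flow_polytope H) (flow_polytope G)"
    and valid: "\<forall>d\<in>D. valid_piece G d"
    by auto
  let ?d = "edge_difference i j k"
  let ?H1 = "reduct1 i j k H" and ?H2 = "reduct2 i j k H"
  have "valid_piece G (H, \<phi>)" using valid reduce.hyps(2) by blast
  then have H: "simple_graph H" "independent (root_vec ` H)"
    and \<phi>: "linear \<phi>" "inj_on \<phi> (flow_polytope H)"
    unfolding valid_piece_def by auto
  note red = H reduce.hyps(3,4)
  note inv = reduct_invariants[OF red] and F = reroute_reducts[OF red]
  have img: "(\<phi> \<circ> reroute i j k) ` flow_polytope ?H1 = \<phi> ` {x \<in> flow_polytope H. ?d x \<ge> 0}"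
    "(\<phi> \<circ> reroute i j k) ` flow_polytope ?H2 = \<phi> ` {x \<in> flow_polytope H. ?d x \<le> 0}"
    unfolding image_comp[symmetric] F by (rule refl)+
  obtain p q where pq: "p \<in> flow_polytope H" "?d p > 0" "q \<in> flow_polytope H" "?d q < 0"
    using ex_positive_negative_flow[OF red] by blast
  note flow_halves =
    linear_image_halves[OF convex_flow_polytope linear_edge_difference \<phi> pq]
  obtain f :: "(real, 'v) vec \<Rightarrow> real" and p' q' where f: "linear f"
    and root: "root_polytope ?H1 = {y \<in> root_polytope H. f y \<ge> 0}"
      "root_polytope ?H2 = {y \<in> root_polytope H. f y \<le> 0}"
    and pq': "p' \<in> root_polytope H" "f p' > 0" "q' \<in> root_polytope H" "f q' < 0"
    by (rule root_reducts[OF red]) (rule that)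
  have "convex (root_polytope H)" by (simp add: root_polytope_def)
  note root_halves = linear_image_halves[OF this f linear_id inj_on_id pq', unfolded image_id id_apply]
  have "indexed_dissection (insert (?H1, \<phi> \<circ> reroute i j k)
      (insert (?H2, \<phi> \<circ> reroute i j k) (D - {(H, \<phi>)}))) (\<lambda>(H, \<phi>). root_polytope H) (root_polytope G)"
  proof (rule indexed_dissection_subdivide[OF dissections(1) reduce.hyps(2)], unfold prod.case)
    show "polytope (root_polytope ?H1)" "polytope (root_polytope ?H2)"
      by (intro polytope_root_polytope inv)+
    show "root_polytope ?H1 \<union> root_polytope ?H2 = root_polytope H"
      unfolding root by auto
  qed (unfold root, (rule root_halves)+)
  moreover have "indexed_dissection (insert (?H1, \<phi> \<circ> reroute i j k)
      (insert (?H2, \<phi> \<circ> reroute i j k) (D - {(H, \<phi>)}))) (\<lambda>(H, \<phi>). \<phi> ` flow_polytope H) (flow_polytope G)"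
  proof (rule indexed_dissection_subdivide[OF dissections(2) reduce.hyps(2)], unfold prod.case)
    show "polytope ((\<phi> \<circ> reroute i j k) ` flow_polytope ?H1)"
      "polytope ((\<phi> \<circ> reroute i j k) ` flow_polytope ?H2)"
      by (intro polytope_linear_image linear_compose linear_reroute \<phi> polytope_flow_polytope inv)+
    show "(\<phi> \<circ> reroute i j k) ` flow_polytope ?H1 \<union> (\<phi> \<circ> reroute i j k) ` flow_polytope ?H2 =
        \<phi> ` flow_polytope H"
      unfolding img image_Un[symmetric] by (rule arg_cong[of _ _ "image \<phi>"]) auto
  qed (unfold img, (rule flow_halves)+)
  moreover have "valid_piece G (?H1, \<phi> \<circ> reroute i j k)" "valid_piece G (?H2, \<phi> \<circ> reroute i j k)"
    using valid_piece_reroute[OF \<open>valid_piece G (H, \<phi>)\<close>] inv F by auto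
  ultimately show ?case using valid by auto
qed

section \<open>Images under \<open>f\<close> after \<open>p\<close>, and affine equivalence\<close>

lemma root_map_proj_map_image:
  assumes "S \<subseteq> flow_polytope E"
  shows "root_map E ` proj_map E ` S = root_map UNIV ` S"
  unfolding image_image root_map_proj_map
proof (intro image_cong refl)
  fix x assume "x \<in> S"
  with assms have "x \<in> flow_polytope E" by blast
  then show "root_map E x = root_map UNIV x"
    by (intro root_map_UNIV_eq[symmetric] flow_polytopeD(1))
qed

text \<open>The coordinate basis of the subspace is mapped bijectively onto the independent roots of
  the edges.\<close>

lemma inj_on_root_map:
  fixes G :: "'v::{finite, linorder} graph"
  assumes "simple_graph G" "independent (root_vec ` G)"
  shows "inj_on (root_map G) (edge_subspace G)"
proof -
  have basis: "{axis (inner_edge e) 1 | e. e \<in> G} = (\<lambda>e. axis (inner_edge e) (1 :: real)) ` G"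
    by auto
  have img: "root_map G ` {axis (inner_edge e) 1 | e. e \<in> G} = root_vec ` G"
    unfolding basis image_image by (intro image_cong) (auto simp: root_map_axis)
  show ?thesis
    unfolding edge_subspace_def
  proof (rule linear_inj_on_span_independent_image[OF linear_root_map])
    show "independent (root_map G ` {axis (inner_edge e) 1 | e. e \<in> G})"
      using assms(2) unfolding img .
    show "inj_on (root_map G) {axis (inner_edge e) 1 | e. e \<in> G}"
      using inj_on_root_vec[OF assms(1)] by (auto simp: inj_on_def root_map_axis)
  qed
qed

text \<open>A linear left inverse of \<open>g\<close> on the span leads from the image back to
  \<open>T\<close>.\<close>

lemma affinely_equivalent_linear_image:
  assumes "linear g" "inj_on g (span S)" "T \<subseteq> span S"
  shows "affinely_equivalent (g ` T) T"
proof -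
  obtain h where h: "linear h" "\<And>x. x \<in> span S \<Longrightarrow> h (g x) = x"
    using linear_inj_on_left_inverse[OF assms(1,2)] by blast
  have "h (g x) = x" if "x \<in> T" for x using h(2) assms(3) that by blast
  then have "bij_betw h (g ` T) T"
    by (intro bij_betwI[of _ _ _ g]) auto
  then have "affine_bijection h (g ` T) T"
    using h(1) unfolding affine_bijection_def by (intro conjI exI[of _ h] exI[of _ 0]) auto
  then show ?thesis unfolding affinely_equivalent_def by blast
qed

theorem theorem4p4:
  fixes G :: "'v::{finite, linorder} graph"
  assumes "simple_graph G" and "acyclic_graph G"
  shows
    "affinely_equivalent (root_polytope G) (projected_flow_polytope G) \<and>
     root_polytope G = root_map G ` (proj_map G ` flow_polytope G) \<and>
     affine_bijection (root_map G) (projected_flow_polytope G) (root_polytope G) \<and>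
     (\<forall>D. reduction_state G D \<longrightarrow>
        is_dissection (root_pieces D) (root_polytope G) \<and>
        is_dissection (flow_pieces D) (flow_polytope G) \<and>
        root_pieces D = (\<lambda>C. (root_map G \<circ> proj_map G) ` C) ` flow_pieces D \<and>
        (\<forall>(H, \<phi>) \<in> D.
           root_map H ` (proj_map H ` flow_polytope H) = root_polytope H \<and>
           root_map G ` (proj_map G ` (\<phi> ` flow_polytope H)) = root_polytope H \<and>
           (\<forall>i j k. i < j \<and> j < k \<and> (i, j) \<in> H \<and> (j, k) \<in> H \<longrightarrow>
              (let H\<^sub>1 = reduct1 i j k H; H\<^sub>2 = reduct2 i j k H; H\<^sub>3 = reduct3 i j k H;
                   \<psi> = \<phi> \<circ> reroute i j k
               in root_polytope H\<^sub>1 \<inter> root_polytope H\<^sub>2 = root_polytope H\<^sub>3 \<and>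
                  (\<psi> ` flow_polytope H\<^sub>1) \<inter> (\<psi> ` flow_polytope H\<^sub>2) = \<psi> ` flow_polytope H\<^sub>3 \<and>
                  root_map H\<^sub>3 ` (proj_map H\<^sub>3 ` flow_polytope H\<^sub>3) = root_polytope H\<^sub>3 \<and>
                  root_map G ` (proj_map G ` (\<psi> ` flow_polytope H\<^sub>3)) = root_polytope H\<^sub>3))))"
proof -
  note simple = assms(1) and indep = independent_root_vec[OF assms]
  have image: "root_polytope G = root_map G ` (proj_map G ` flow_polytope G)"
    by (simp add: root_map_proj_map_image root_polytope_eq[OF simple])
  have sub: "projected_flow_polytope G \<subseteq> edge_subspace G"
    by (auto simp: projected_flow_polytope_def proj_map_in_edge_subspace)
  note inj = inj_on_root_map[OF simple indep]
  have bij: "affine_bijection (root_map G) (projected_flow_polytope G) (root_polytope G)"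
    unfolding affine_bijection_def bij_betw_def
    using linear_root_map[of G] inj_on_subset[OF inj sub] image
    by (intro conjI exI[of _ "root_map G"] exI[of _ 0]) (auto simp: projected_flow_polytope_def)
  have equiv: "affinely_equivalent (root_polytope G) (projected_flow_polytope G)"
    using affinely_equivalent_linear_image[OF linear_root_map inj[unfolded edge_subspace_def]
        sub[unfolded edge_subspace_def]] image
    by (simp add: projected_flow_polytope_def)
  show ?thesis
  proof (intro conjI allI impI equiv image bij)
    fix D assume "reduction_state G D"
    note invariant = reduction_state_invariant[OF simple indep this]
    have root: "root_pieces D = (\<lambda>(H, \<phi>). root_polytope H) ` D"
      by (force simp: root_pieces_def)
    have flow: "flow_pieces D = (\<lambda>(H, \<phi>). \<phi> ` flow_polytope H) ` D"
      by (force simp: flow_pieces_def)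
    show "is_dissection (root_pieces D) (root_polytope G)"
      "is_dissection (flow_pieces D) (flow_polytope G)"
      unfolding root flow using invariant indexed_dissection_imp_is_dissection by blast+
    have valid: "simple_graph H" "independent (root_vec ` H)" "inj_on \<phi> (flow_polytope H)"
      "\<phi> ` flow_polytope H \<subseteq> flow_polytope G" "root_map UNIV (\<phi> x) = root_map UNIV x"
      if "(H, \<phi>) \<in> D" for H \<phi> x
    proof -
      have "valid_piece G (H, \<phi>)" using invariant that by blast
      then show "simple_graph H" "independent (root_vec ` H)" "inj_on \<phi> (flow_polytope H)"
        "\<phi> ` flow_polytope H \<subseteq> flow_polytope G" "root_map UNIV (\<phi> x) = root_map UNIV x"
        unfolding valid_piece_def by simp_all
    qed
    have piece: "root_map G ` proj_map G ` \<phi> ` flow_polytope H = root_polytope H" if "(H, \<phi>) \<in> D" for H \<phi>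
      unfolding root_map_proj_map_image[OF valid(4)[OF that]] root_polytope_eq[OF valid(1)[OF that]]
      by (simp add: image_image valid(5)[OF that])
    show "root_pieces D = (\<lambda>C. (root_map G \<circ> proj_map G) ` C) ` flow_pieces D"
      unfolding root flow image_image[of _ _ D] image_comp[symmetric]
    \<comment> \<open>Both families are indexed by \<open>D\<close>, so pieces with the same index
      are compared.\<close>
    proof (intro image_cong refl)
      fix d assume "d \<in> D"
      then show "(case d of (H, \<phi>) \<Rightarrow> root_polytope H) =
          root_map G ` proj_map G ` (case d of (H, \<phi>) \<Rightarrow> \<phi> ` flow_polytope H)"
        using piece by (cases d) (simp only: prod.case)
    qed
    show "\<forall>(H, \<phi>) \<in> D.
           root_map H ` (proj_map H ` flow_polytope H) = root_polytope H \<and>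
           root_map G ` (proj_map G ` (\<phi> ` flow_polytope H)) = root_polytope H \<and>
           (\<forall>i j k. i < j \<and> j < k \<and> (i, j) \<in> H \<and> (j, k) \<in> H \<longrightarrow>
              (let H\<^sub>1 = reduct1 i j k H; H\<^sub>2 = reduct2 i j k H; H\<^sub>3 = reduct3 i j k H;
                   \<psi> = \<phi> \<circ> reroute i j k
               in root_polytope H\<^sub>1 \<inter> root_polytope H\<^sub>2 = root_polytope H\<^sub>3 \<and>
                  (\<psi> ` flow_polytope H\<^sub>1) \<inter> (\<psi> ` flow_polytope H\<^sub>2) = \<psi> ` flow_polytope H\<^sub>3 \<and>
                  root_map H\<^sub>3 ` (proj_map H\<^sub>3 ` flow_polytope H\<^sub>3) = root_polytope H\<^sub>3 \<and>
                  root_map G ` (proj_map G ` (\<psi> ` flow_polytope H\<^sub>3)) = root_polytope H\<^sub>3))"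
      unfolding Let_def
    proof (clarify, intro conjI allI impI; (elim conjE)?)
      fix H \<phi> assume "(H, \<phi>) \<in> D"
      note H = valid[OF this]
      show "root_map H ` proj_map H ` flow_polytope H = root_polytope H"
        by (simp add: root_map_proj_map_image root_polytope_eq[OF H(1)])
      show "root_map G ` proj_map G ` \<phi> ` flow_polytope H = root_polytope H"
        using piece[OF \<open>(H, \<phi>) \<in> D\<close>] .
      fix i j k assume "(i, j) \<in> H" "(j, k) \<in> H"
      note red = H(1,2) this
      let ?H1 = "reduct1 i j k H" and ?H2 = "reduct2 i j k H" and ?H3 = "reduct3 i j k H"
        and ?\<psi> = "\<phi> \<circ> reroute i j k"
      note F = reroute_reducts[OF red] and simple3 = reduct_invariants(6)[OF red]
      show "root_polytope ?H1 \<inter> root_polytope ?H2 = root_polytope ?H3"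
        by (rule root_reducts[OF red]) auto
      show "?\<psi> ` flow_polytope ?H1 \<inter> ?\<psi> ` flow_polytope ?H2 = ?\<psi> ` flow_polytope ?H3"
      proof -
        \<comment> \<open>Only \<open>\<phi>\<close> is taken out of the intersection, being
          injective on the flow polytope of \<open>H\<close>; the rerouted sets are the two halves
          of that polytope.\<close>
        have "?\<psi> ` flow_polytope ?H1 \<inter> ?\<psi> ` flow_polytope ?H2 =
            \<phi> ` (reroute i j k ` flow_polytope ?H1 \<inter> reroute i j k ` flow_polytope ?H2)"
          unfolding image_comp[symmetric]
          by (rule inj_on_image_Int[OF H(3), symmetric]) (auto simp: F)
        also have "reroute i j k ` flow_polytope ?H1 \<inter> reroute i j k ` flow_polytope ?H2 =
            reroute i j k ` flow_polytope ?H3"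
          unfolding F by auto
        finally show ?thesis by (simp add: image_comp)
      qed
      show "root_map ?H3 ` proj_map ?H3 ` flow_polytope ?H3 = root_polytope ?H3"
        by (simp add: root_map_proj_map_image root_polytope_eq[OF simple3])
      have "?\<psi> ` flow_polytope ?H3 \<subseteq> flow_polytope G"
        using H(4) F(3) by (auto simp: image_comp[symmetric])
      then show "root_map G ` proj_map G ` ?\<psi> ` flow_polytope ?H3 = root_polytope ?H3"
        unfolding root_polytope_eq[OF simple3]
        by (subst root_map_proj_map_image) (simp_all add: image_image H(5) root_map_reroute)
    qed
  qed
qed

end
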